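(* $\mathrm{DWO}\text{-}\mathrm{PSPACE} = \mathrm{P}$. That is, a language is decided by some deterministic write-once Turing machine using at most $n^t$ tape cells on inputs of length $n$ (for some constant $t$) if and only if it is decided by some ordinary deterministic Turing machine in polynomial time.
   Context: A write-once Turing machine is a Turing machine with a single tape, infinite in one direction, a single read/write head, and a two-symbol tape alphabet $\{0,1\}$ (0 = blank, 1 = marked), with the restriction that it may never write a blank onto a cell containing a marked symbol (marking an already marked cell is allowed and does not change the tape). Its space usage is the number of tape cells used. $\mathrm{DWO}\text{-}\mathrm{PSPACE}$ is the class of languages decided by deterministic write-once Turing machines within polynomial space. *)

theory Defs
  imports Main
begin

datatype move = Left | Stay | Right

text \<open>
  Deterministic single-tape machines. States and tape symbols are coded as initial segments of the
  natural numbers; symbol 0 is the blank. The record type also contains junk, which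
  \<open>turing_machine\<close> below rules out.
\<close>

record tm =
  num_states :: nat
  num_symbols :: nat
  start :: nat
  accept :: nat
  reject :: nat
  delta :: "nat \<Rightarrow> nat \<Rightarrow> nat \<times> nat \<times> move"

definition turing_machine :: "tm \<Rightarrow> bool" where
  "turing_machine M \<longleftrightarrow>
     start M < num_states M \<and> accept M < num_states M \<and> reject M < num_states M \<and>
     accept M \<noteq> reject M \<and> num_symbols M \<ge> 2 \<and>
     (\<forall>q < num_states M. \<forall>a < num_symbols M. \<forall>q' b d. delta M q a = (q', b, d) \<longrightarrow>
        q' < num_states M \<and> b < num_symbols M)"

text \<open>With the two symbols 0 (blank) and 1 (marked), no transition turns a 1 into a 0.\<close>

definition write_once :: "tm \<Rightarrow> bool" where
  "write_once M \<longleftrightarrow>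
     turing_machine M \<and> num_symbols M = 2 \<and>
     (\<forall>q < num_states M. \<forall>q' b d. delta M q 1 = (q', b, d) \<longrightarrow> b \<noteq> 0)"

record config =
  state :: nat
  head :: nat
  tape :: "nat \<Rightarrow> nat"

text \<open>
  Cells are numbered from the left end of the tape. Truncated subtraction makes the head stay put
  on an attempt to move left from cell 0.
\<close>

fun move_head :: "move \<Rightarrow> nat \<Rightarrow> nat" where
  "move_head Left i = i - 1"
| "move_head Stay i = i"
| "move_head Right i = i + 1"

definition halted :: "tm \<Rightarrow> config \<Rightarrow> bool" where
  "halted M c \<longleftrightarrow> state c = accept M \<or> state c = reject M"

definition step :: "tm \<Rightarrow> config \<Rightarrow> config" where
  "step M c =
     (if halted M c then c
      else case delta M (state c) (tape c (head c)) of (q, b, d) \<Rightarrow>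
        \<lparr>state = q, head = move_head d (head c), tape = (tape c)(head c := b)\<rparr>)"

definition initial :: "tm \<Rightarrow> nat list \<Rightarrow> config" where
  "initial M xs =
     \<lparr>state = start M, head = 0, tape = (\<lambda>i. if i < length xs then xs ! i else 0)\<rparr>"

definition run :: "tm \<Rightarrow> nat list \<Rightarrow> nat \<Rightarrow> config" where
  "run M xs n = (step M ^^ n) (initial M xs)"

text \<open>
  Languages are sets of words over the binary alphabet \<^typ>\<open>bool\<close>; the parameter \<open>enc\<close> is the
  tape representation of the input word.
\<close>

definition decides :: "(bool list \<Rightarrow> nat list) \<Rightarrow> tm \<Rightarrow> bool list set \<Rightarrow> bool" where
  "decides enc M L \<longleftrightarrow>
     (\<forall>w. \<exists>n. state (run M (enc w) n) = (if w \<in> L then accept M else reject M))"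

definition running_time :: "tm \<Rightarrow> nat list \<Rightarrow> nat" where
  "running_time M xs = (LEAST n. halted M (run M xs n))"

definition visited_cells :: "tm \<Rightarrow> nat list \<Rightarrow> nat set" where
  "visited_cells M xs = range (\<lambda>n. head (run M xs n))"

text \<open>
  Only meaningful for halting computations, whose set of visited cells is finite
  (\<open>decides_halts\<close> and \<open>finite_visited_cells\<close> below).
\<close>

definition space_usage :: "tm \<Rightarrow> nat list \<Rightarrow> nat" where
  "space_usage M xs = card (visited_cells M xs)"

lemma run_halted:
  assumes "halted M (run M xs n)" and "n \<le> m"
  shows "run M xs m = run M xs n"
  using assms(2)
proof (induction m rule: dec_induct)
  case base
  show ?case by simp
next
  case (step k)
  then show ?case using assms(1) by (simp add: run_def step_def)
qed

lemma decides_halts: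
  assumes "decides enc M L"
  shows "\<exists>n. halted M (run M (enc w) n)"
  using assms unfolding decides_def halted_def by metis

lemma finite_visited_cells:
  assumes "halted M (run M xs n)"
  shows "finite (visited_cells M xs)"
proof -
  have "visited_cells M xs \<subseteq> (\<lambda>k. head (run M xs k)) ` {..n}"
  proof
    fix i assume "i \<in> visited_cells M xs"
    then obtain k where k: "i = head (run M xs k)"
      by (auto simp: visited_cells_def)
    show "i \<in> (\<lambda>k. head (run M xs k)) ` {..n}"
    proof (cases "k \<le> n")
      case True
      then show ?thesis using k by auto
    next
      case False
      then have "i = head (run M xs n)"
        using k run_halted[OF assms, of k] by simp
      then show ?thesis by auto
    qed
  qed
  then show ?thesis by (rule finite_subset) simp
qed

text \<open>An ordinary machine has two input symbols, 1 and 2, besides the blank 0.\<close>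

definition plain_input :: "bool list \<Rightarrow> nat list" where
  "plain_input w = map (\<lambda>b. if b then 2 else 1) w"

text \<open>
  With tape alphabet \<open>{0, 1}\<close> and 0 as the blank, a binary word cannot be written on the tape
  as it stands: \<open>w\<close> and \<open>w0\<close> would give the same tape. Each input bit therefore occupies
  two cells, 01 for 0 and 10 for 1. A marked block 11 is still available for a processed bit,
  and the block 00 delimits the input. Lengths below always refer to the word itself.
\<close>

definition paired_input :: "bool list \<Rightarrow> nat list" where
  "paired_input w = concat (map (\<lambda>b. if b then [1, 0] else [0, 1]) w)"

text \<open>
  A bound \<open>n ^ t\<close> is constant for \<open>n = 0\<close> and \<open>n = 1\<close> whatever the exponent. The
  summand \<open>t\<close> only serves these lengths; see \<open>power_bound_iff\<close> for the bound without it.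
\<close>

definition DWO_PSPACE :: "bool list set set" where
  "DWO_PSPACE =
     {L. \<exists>M. write_once M \<and> decides paired_input M L \<and>
           (\<exists>t. \<forall>w. space_usage M (paired_input w) \<le> length w ^ t + t)}"

definition PTIME :: "bool list set set" where
  "PTIME =
     {L. \<exists>M. turing_machine M \<and> num_symbols M \<ge> 3 \<and> decides plain_input M L \<and>
           (\<exists>t. \<forall>w. running_time M (plain_input w) \<le> length w ^ t + t)}"

lemma power_bound_iff:
  fixes f :: "bool list \<Rightarrow> nat"
  shows "(\<exists>t. \<forall>w. f w \<le> length w ^ t + t) \<longleftrightarrow> (\<exists>t. \<forall>w. length w \<ge> 2 \<longrightarrow> f w \<le> length w ^ t)"
proof
  assume "\<exists>t. \<forall>w. f w \<le> length w ^ t + t"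
  then obtain t where t: "\<And>w. f w \<le> length w ^ t + t" by blast
  have "f w \<le> length w ^ Suc t" if "length w \<ge> 2" for w
  proof -
    have "t < 2 ^ t" by (rule less_exp)
    also have "(2::nat) ^ t \<le> length w ^ t" using that by (rule power_mono) simp
    finally have "f w \<le> 2 * length w ^ t" using t[of w] by simp
    also have "\<dots> \<le> length w * length w ^ t" using that by (rule mult_le_mono1)
    finally show ?thesis by simp
  qed
  then show "\<exists>t. \<forall>w. length w \<ge> 2 \<longrightarrow> f w \<le> length w ^ t" by blast
next
  assume "\<exists>t. \<forall>w. length w \<ge> 2 \<longrightarrow> f w \<le> length w ^ t"
  then obtain t where t: "\<And>w. length w \<ge> 2 \<Longrightarrow> f w \<le> length w ^ t" by blast
  define u where "u = t + f [] + f [False] + f [True]"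
  have "f w \<le> length w ^ u + u" for w
  proof (cases "length w \<ge> 2")
    case True
    have "length w ^ t \<le> length w ^ u"
      using True by (intro power_increasing) (auto simp: u_def)
    then show ?thesis using t[OF True] by simp
  next
    case False
    then have "w = [] \<or> w = [False] \<or> w = [True]"
      by (cases w) (auto simp: Suc_le_eq)
    then have "f w \<le> u" by (auto simp: u_def)
    then show ?thesis by simp
  qed
  then show "\<exists>t. \<forall>w. f w \<le> length w ^ t + t" by blast
qed

end

theory Submission
  imports Defs
begin

text \<open>
  A write-once computation that uses \<open>s\<close> cells changes its tape at most \<open>s\<close> times, and between two
  changes a halting computation repeats no pair of state and head position; so polynomial space
  forces polynomial time.

  Conversely, a write-once machine can maintain a first-in first-out queue. With the symbol \<open>a\<close>
  coded as \<open>0\<close> followed by \<open>a + 1\<close> marks, the front symbol is consumed by marking its leading 0, so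
  the tape always consists of a block of marks, the codes of the symbols in the queue, and blanks. The
  queue holds a configuration of the ordinary machine, closed by a separator; one pass over it
  appends the successor configuration, each new cell depending only on its old neighbourhood. This
  costs polynomially many cells for polynomially many steps.
\<close>

subsection \<open>Polynomial bounds\<close>

text \<open>A cell changes at most once, so every step of the ordinary machine is paid for with a
  fresh copy of its configuration. A run of \<open>T\<close> steps on \<open>n\<close> bits needs
  \<open>T + 1\<close> copies of at most \<open>n + T + 1\<close> symbols, each costing a bounded
  number of cells; this is polynomial because \<open>T\<close> is. The time of the write-once
  machine is never estimated: it suffices that it halts with its head inside a stretch of tape fixed
  in advance. A finite control cannot remember positions, so the code must make three places
  recognizable locally: the front of the queue, its end, and the block of marks on its left.
  Moreover the input is not given in this code; it is converted bit by bit, with one round trip for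
  each bit.\<close>

definition poly_bounded :: "(bool list \<Rightarrow> nat) \<Rightarrow> bool" where
  "poly_bounded f \<longleftrightarrow> (\<exists>t. \<forall>w. f w \<le> length w ^ t + t)"

lemma poly_bounded_mono: "poly_bounded g \<Longrightarrow> (\<And>w. f w \<le> g w) \<Longrightarrow> poly_bounded f"
  unfolding poly_bounded_def by (meson order_trans)

lemma poly_bounded_const: "poly_bounded (\<lambda>_. c)"
  unfolding poly_bounded_def by (auto intro!: exI[of _ c])

lemma poly_bounded_length: "poly_bounded length"
  unfolding poly_bounded_def by (auto intro!: exI[of _ 1])

text \<open>For lengths at least 2, \<open>power_bound_iff\<close> absorbs the summand
  \<open>t\<close>, and exponents simply add.\<close>

lemma poly_bounded_mult:
  assumes "poly_bounded f" "poly_bounded g"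
  shows "poly_bounded (\<lambda>w. f w * g w)"
proof -
  obtain a where a: "\<And>w. length w \<ge> 2 \<Longrightarrow> f w \<le> length w ^ a"
    using assms(1) unfolding poly_bounded_def power_bound_iff by blast
  obtain b where b: "\<And>w. length w \<ge> 2 \<Longrightarrow> g w \<le> length w ^ b"
    using assms(2) unfolding poly_bounded_def power_bound_iff by blast
  have "f w * g w \<le> length w ^ (a + b)" if "length w \<ge> 2" for w
    using mult_le_mono[OF a[OF that] b[OF that]] by (simp add: power_add)
  then show ?thesis unfolding poly_bounded_def power_bound_iff by blast
qed

text \<open>The inequality \<open>f w + g w \<le> Suc (f w) * Suc (g w)\<close> reduces sums to
  products and increments by one.\<close>

lemma poly_bounded_add:
  assumes "poly_bounded f" "poly_bounded g"
  shows "poly_bounded (\<lambda>w. f w + g w)"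
proof (rule poly_bounded_mono)
  have "poly_bounded (\<lambda>w. Suc (f w))" if "poly_bounded f" for f :: "bool list \<Rightarrow> nat"
  proof -
    obtain t where t: "\<And>w. f w \<le> length w ^ t + t"
      using \<open>poly_bounded f\<close> unfolding poly_bounded_def by blast
    \<comment> \<open>At length 0 with \<open>t = 0\<close> the bound on \<open>f w\<close> is
      \<open>0 ^ 0 + 0 = 1\<close>, so \<open>t + 1\<close> would be too small.\<close>
    have "Suc (f w) \<le> length w ^ (t + 2) + (t + 2)" for w
    proof (cases "length w = 0")
      case True
      then show ?thesis using t[of w] by (cases t) auto
    next
      case False
      then have "length w ^ t \<le> length w ^ (t + 2)"
        by (intro power_increasing) (auto simp: Suc_le_eq)
      then show ?thesis using t[of w] by linarith
    qed
    then show ?thesis unfolding poly_bounded_def by blast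
  qed
  then show "poly_bounded (\<lambda>w. Suc (f w) * Suc (g w))"
    using assms by (intro poly_bounded_mult) auto
  show "f w + g w \<le> Suc (f w) * Suc (g w)" for w by simp
qed

lemmas poly_bounded_intros =
  poly_bounded_const poly_bounded_length poly_bounded_add poly_bounded_mult

subsection \<open>Write-once machines in polynomial time\<close>

lemma turing_machine_delta:
  assumes "turing_machine M" "q < num_states M" "a < num_symbols M" "delta M q a = (q', b, d)"
  shows "q' < num_states M" "b < num_symbols M"
  using assms unfolding turing_machine_def by blast+

lemma run_0: "run M xs 0 = initial M xs"
  and run_Suc: "run M xs (Suc n) = step M (run M xs n)"
  by (simp_all add: run_def)

lemma run_cong:
  assumes "run M xs i = run M xs j"
  shows "run M xs (i + k) = run M xs (j + k)"
  using assms by (induction k) (simp_all add: run_Suc)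

lemma run_wellformed:
  assumes "turing_machine M" and "set xs \<subseteq> {..<num_symbols M}"
  shows "state (run M xs n) < num_states M \<and> tape (run M xs n) i < num_symbols M"
proof (induction n arbitrary: i)
  case 0
  have "xs ! i < num_symbols M" if "i < length xs" using assms(2) nth_mem[OF that] by auto
  then show ?case using assms(1) by (simp add: run_0 initial_def turing_machine_def)
next
  case (Suc n)
  let ?c = "run M xs n"
  obtain q b d where d: "delta M (state ?c) (tape ?c (head ?c)) = (q, b, d)"
    by (metis prod_cases3)
  have "q < num_states M" "b < num_symbols M"
    using turing_machine_delta[OF assms(1) _ _ d] Suc by blast+
  then show ?case using Suc d by (simp add: run_Suc step_def)
qed

lemma running_time_halted:
  assumes "halted M (run M xs n)"
  shows "halted M (run M xs (running_time M xs))"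
  unfolding running_time_def using assms by (rule LeastI)

lemma running_time_le: "halted M (run M xs n) \<Longrightarrow> running_time M xs \<le> n"
  unfolding running_time_def by (rule Least_le)

lemma run_tape_unvisited:
  assumes "i \<notin> visited_cells M xs"
  shows "tape (run M xs n) i = tape (initial M xs) i"
proof (induction n)
  case (Suc n)
  have "i \<noteq> head (run M xs n)" using assms by (auto simp: visited_cells_def)
  then show ?case using Suc by (simp add: run_Suc step_def split: prod.split)
qed (simp add: run_0)

lemma write_once_tape_mono:
  assumes "write_once M" and "set xs \<subseteq> {..<2}" and "n \<le> m" and "tape (run M xs n) i = 1"
  shows "tape (run M xs m) i = 1"
  using assms(3)
proof (induction m rule: dec_induct)
  case base
  show ?case by (rule assms)
next
  case (step m)
  let ?c = "run M xs m"
  have tm: "turing_machine M" and two: "num_symbols M = 2"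
    using assms(1) by (auto simp: write_once_def)
  have wf: "state ?c < num_states M" "tape (run M xs (Suc m)) i < 2"
    using run_wellformed[OF tm] assms(2) two by simp_all
  obtain q b d where d: "delta M (state ?c) (tape ?c (head ?c)) = (q, b, d)"
    by (metis prod_cases3)
  have "b \<noteq> 0" if "i = head ?c"
    using assms(1) d wf step.IH that unfolding write_once_def by auto
  then have "tape (run M xs (Suc m)) i \<noteq> 0"
    using step.IH d by (auto simp: run_Suc step_def)
  then show ?case using wf(2) by simp
qed

text \<open>Before halting, the triple \<open>g i\<close> never repeats. Its head position takes at
  most \<open>space_usage M xs\<close> values and its number of marks one more. Marks are counted on
  visited cells only, since the rest of the tape keeps its initial contents.\<close>

lemma write_once_running_time:
  assumes "write_once M" and "set xs \<subseteq> {..<2}" and halts: "halted M (run M xs n)"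
  shows "running_time M xs \<le> num_states M * (space_usage M xs * Suc (space_usage M xs))"
proof -
  define T where "T = running_time M xs"
  define V where "V = visited_cells M xs"
  define marked where "marked i = {j \<in> V. tape (run M xs i) j = 1}" for i
  define g where "g i = (state (run M xs i), head (run M xs i), card (marked i))" for i
  have finV: "finite V" unfolding V_def by (rule finite_visited_cells[OF halts])
  have fin: "finite (marked i)" for i using finV by (simp add: marked_def)
  have two: "num_symbols M = 2" and tm: "turing_machine M"
    using assms(1) by (auto simp: write_once_def)
  have wf: "state (run M xs i) < num_states M" "tape (run M xs i) j < 2" for i j
    using run_wellformed[OF tm] assms(2) two by simp_all
  have no_repeat: False if "i < j" "j < T" "g i = g j" for i j
  proof -
    \<comment> \<open>Marks only accumulate, so equal numbers of marks mean equal sets.\<close>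
    have "marked i \<subseteq> marked j"
      using write_once_tape_mono[OF assms(1,2), of i j] that(1) by (auto simp: marked_def)
    then have "marked i = marked j"
      using that(3) fin by (intro card_subset_eq) (auto simp: g_def)
    then have "tape (run M xs i) p = tape (run M xs j) p" if "p \<in> V" for p
    proof -
      have "tape (run M xs i) p = 1 \<longleftrightarrow> tape (run M xs j) p = 1"
        using that \<open>marked i = marked j\<close> unfolding marked_def by blast
      then show ?thesis using wf(2)[of i p] wf(2)[of j p] by (metis less_2_cases_iff One_nat_def)
    qed
    moreover have "tape (run M xs i) p = tape (run M xs j) p" if "p \<notin> V" for p
      using that run_tape_unvisited[of p M xs] by (simp add: V_def)
    ultimately have "tape (run M xs i) = tape (run M xs j)" by blast
    then have "run M xs i = run M xs j" using that(3) by (simp add: g_def)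
    \<comment> \<open>The run from time \<open>i\<close> repeats the one from time \<open>j\<close>,
      so it would halt \<open>j - i\<close> steps before \<open>T\<close>.\<close>
    then have "run M xs (i + (T - j)) = run M xs T"
      using run_cong[of M xs i j "T - j"] that(2) by simp
    then have "halted M (run M xs (i + (T - j)))"
      using running_time_halted[OF halts] by (simp add: T_def)
    then have "T \<le> i + (T - j)" unfolding T_def by (rule running_time_le)
    then show False using that by linarith
  qed
  have "inj_on g {..<T}"
  proof (rule inj_onI)
    fix i j assume "i \<in> {..<T}" "j \<in> {..<T}" "g i = g j"
    then show "i = j" using no_repeat[of i j] no_repeat[of j i] by (cases i j rule: linorder_cases) auto
  qed
  moreover have "g ` {..<T} \<subseteq> {..<num_states M} \<times> (V \<times> {..card V})"
    using wf finV by (auto simp: g_def V_def visited_cells_def marked_def intro!: card_mono)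
  ultimately have "card {..<T} \<le> card ({..<num_states M} \<times> (V \<times> {..card V}))"
    using finV by (intro card_inj_on_le) auto
  then show ?thesis
    by (simp add: T_def V_def space_usage_def card_cartesian_product del: mult_Suc_right)
qed

text \<open>
  Cell \<open>i\<close> of the simulating machine holds cells \<open>2 * i\<close> and \<open>2 * i + 1\<close>, with 4 added to mark
  the left end of the tape; with this encoding \<open>plain_input\<close> already represents \<open>paired_input\<close>.
  Halting states drop the parity of the head position, as there must be only one of each kind.
\<close>

definition pair_state :: "tm \<Rightarrow> nat \<Rightarrow> nat \<Rightarrow> nat" where
  "pair_state M q h = (if q = accept M \<or> q = reject M then 2 * q else 2 * q + h)"

text \<open>A packed symbol is \<open>4 * e + 2 * a + b\<close>, with \<open>e\<close> the end mark,
  \<open>a\<close> the even and \<open>b\<close> the odd cell; the parity \<open>h\<close> selects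
  which of the two is replaced.\<close>

definition pair_write :: "nat \<Rightarrow> nat \<Rightarrow> nat \<Rightarrow> nat" where
  "pair_write h v b =
     4 * (v div 4) + (if h = 0 then 2 * b + v mod 2 else 2 * (v div 2 mod 2) + b)"

fun pair_move :: "nat \<Rightarrow> nat \<Rightarrow> move \<Rightarrow> nat \<times> move" where
  "pair_move h v Stay = (h, Stay)"
| "pair_move h v Right = (if h = 0 then (1, Stay) else (0, Right))"
| "pair_move h v Left = (if h = 1 \<or> v \<ge> 4 then (0, Stay) else (1, Left))"

text \<open>The extra start state spends one step on setting the end mark in cell 0; this is the
  offset \<open>Suc n\<close> in \<open>pair_rel_run\<close>.\<close>

definition pair_tm :: "tm \<Rightarrow> tm" where
  "pair_tm M =
     \<lparr>num_states = 2 * num_states M + 1, num_symbols = 8, start = 2 * num_states M,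
      accept = 2 * accept M, reject = 2 * reject M,
      delta = (\<lambda>s v.
        if s = 2 * num_states M then (pair_state M (start M) 0, v mod 4 + 4, Stay)
        else case delta M (s div 2) (if s mod 2 = 0 then v div 2 mod 2 else v mod 2) of
          (q, b, d) \<Rightarrow> case pair_move (s mod 2) v d of
            (h, d') \<Rightarrow> (pair_state M q h, pair_write (s mod 2) v b, d'))\<rparr>"

lemma pair_move_less: "h < 2 \<Longrightarrow> pair_move h v d = (h', d') \<Longrightarrow> h' < 2"
  by (cases d) (auto split: if_splits)

lemma pair_write_less: "v < 8 \<Longrightarrow> b < 2 \<Longrightarrow> pair_write h v b < 8"
proof -
  assume "v < 8" "b < 2"
  moreover from this have "v div 4 < 2" by (simp add: less_mult_imp_div_less)
  moreover have "v mod 2 < 2" "v div 2 mod 2 < 2" by simp_all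
  ultimately have "4 * (v div 4) + (2 * b + v mod 2) < 8"
    "4 * (v div 4) + (2 * (v div 2 mod 2) + b) < 8" by linarith+
  then show ?thesis by (simp add: pair_write_def)
qed

lemma pair_state_less: "q < n \<Longrightarrow> h < 2 \<Longrightarrow> pair_state M q h < 2 * n + 1"
  unfolding pair_state_def by auto

lemma turing_machine_pair_tm:
  assumes "turing_machine M" "num_symbols M = 2"
  shows "turing_machine (pair_tm M)"
proof -
  have "q' < num_states (pair_tm M) \<and> b < num_symbols (pair_tm M)"
    if "s < num_states (pair_tm M)" "v < num_symbols (pair_tm M)" "delta (pair_tm M) s v = (q', b, d)"
    for s v q' b d
  proof (cases "s = 2 * num_states M")
    case True
    then have "q' = pair_state M (start M) 0" "b = v mod 4 + 4"
      using that(3) by (simp_all add: pair_tm_def)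
    then show ?thesis
      using assms pair_state_less[of "start M" "num_states M" 0 M]
      by (simp add: pair_tm_def turing_machine_def)
  next
    case False
    let ?a = "if s mod 2 = 0 then v div 2 mod 2 else v mod 2"
    obtain p c e where pce: "delta M (s div 2) ?a = (p, c, e)" by (metis prod_cases3)
    obtain h m where hm: "pair_move (s mod 2) v e = (h, m)" by fastforce
    have "s div 2 < num_states M" using False that(1) by (simp add: pair_tm_def)
    then have "p < num_states M" "c < 2"
      using turing_machine_delta[OF assms(1) _ _ pce] assms(2) by simp_all
    moreover have "q' = pair_state M p h" "b = pair_write (s mod 2) v c"
      using that(3) False pce hm by (simp_all add: pair_tm_def)
    ultimately show ?thesis
      using that(2) pair_move_less[OF _ hm] pair_state_less[of p "num_states M" h M]
        pair_write_less[of v c] by (simp add: pair_tm_def)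
  qed
  moreover have "start (pair_tm M) < num_states (pair_tm M)" "accept (pair_tm M) < num_states (pair_tm M)"
    "reject (pair_tm M) < num_states (pair_tm M)" "accept (pair_tm M) \<noteq> reject (pair_tm M)"
    "num_symbols (pair_tm M) \<ge> 2"
    using assms(1) by (simp_all add: turing_machine_def pair_tm_def)
  ultimately show ?thesis unfolding turing_machine_def by blast
qed

definition pair_rel :: "tm \<Rightarrow> config \<Rightarrow> config \<Rightarrow> bool" where
  "pair_rel M c c' \<longleftrightarrow>
     state c' = pair_state M (state c) (head c mod 2) \<and>
     (\<not> halted M c \<longrightarrow> head c' = head c div 2 \<and>
        (\<forall>i. tape c' i = (if i = 0 then 4 else 0) + 2 * tape c (2 * i) + tape c (2 * i + 1)))"

text \<open>The second hypothesis says that \<open>v\<close> carries the end mark exactly in packed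
  cell 0. There a left move from the even half must stay; switching halves together with a truncated
  left move would lead to cell 1.\<close>

lemma move_head_pair_move:
  assumes "pair_move (h mod 2) v d = (h', d')" and "v \<ge> 4 \<longleftrightarrow> h div 2 = 0"
  shows "move_head d' (h div 2) = move_head d h div 2" and "h' = move_head d h mod 2"
proof -
  have "move_head d' (h div 2) = move_head d h div 2 \<and> h' = move_head d h mod 2"
  proof (cases "even h")
    case True
    then obtain g where "h = 2 * g" by blast
    then show ?thesis using assms by (cases d; cases g) (auto split: if_splits)
  next
    case False
    then obtain g where "h = 2 * g + 1" by (rule oddE)
    then show ?thesis using assms by (cases d) (auto split: if_splits)
  qed
  then show "move_head d' (h div 2) = move_head d h div 2" "h' = move_head d h mod 2" by auto
qed

lemma pair_rel_step:
  assumes rel: "pair_rel M c c'"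
    and st: "state c < num_states M" and two: "\<And>i. tape c i < 2"
  shows "pair_rel M (step M c) (step (pair_tm M) c')"
proof (cases "halted M c")
  case True
  then have "halted (pair_tm M) c'"
    using rel by (auto simp: pair_rel_def halted_def pair_state_def pair_tm_def)
  then show ?thesis using True rel by (simp add: step_def)
next
  case False
  define h where "h = head c"
  define v where "v = tape c' (h div 2)"
  define a b where "a = tape c (2 * (h div 2))" and "b = tape c (2 * (h div 2) + 1)"
  obtain q x d where qxd: "delta M (state c) (tape c h) = (q, x, d)" by (metis prod_cases3)
  obtain h' d' where hd: "pair_move (h mod 2) v d = (h', d')" by fastforce
  have st': "state c' = 2 * state c + h mod 2" and hd': "head c' = h div 2"
    and tp: "\<And>i. tape c' i = (if i = 0 then 4 else 0) + 2 * tape c (2 * i) + tape c (2 * i + 1)"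
    using rel False by (auto simp: pair_rel_def halted_def pair_state_def h_def)
  have ab: "a < 2" "b < 2" using two by (auto simp: a_def b_def)
  have v: "v = (if h div 2 = 0 then 4 else 0) + 2 * a + b"
    unfolding v_def tp a_def b_def ..
  have v4: "v \<ge> 4 \<longleftrightarrow> h div 2 = 0" using v ab by auto
  have va: "v div 2 mod 2 = a" "v mod 2 = b" "4 * (v div 4) = (if h div 2 = 0 then 4 else 0)"
    using ab unfolding v by (auto simp: less_2_cases_iff)
  have half: "if h mod 2 = 0 then 2 * (h div 2) = h \<and> Suc (2 * (h div 2)) \<noteq> h
      else Suc (2 * (h div 2)) = h \<and> 2 * (h div 2) \<noteq> h"
    by presburger
  have read: "tape c h = (if h mod 2 = 0 then v div 2 mod 2 else v mod 2)"
    unfolding va a_def b_def using half by simp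
  have ne: "state c' \<noteq> 2 * num_states M" using st st' by linarith
  have nh: "\<not> halted (pair_tm M) c'"
    using False st' by (auto simp: halted_def pair_tm_def; presburger)
  have sd: "state c' div 2 = state c" "state c' mod 2 = h mod 2" using st' by auto
  have del: "delta (pair_tm M) (state c') (tape c' (head c')) =
      (pair_state M q h', pair_write (h mod 2) v x, d')"
    using qxd hd ne unfolding pair_tm_def hd' v_def[symmetric]
    by (simp add: sd read)
  have new: "tape (step (pair_tm M) c') i =
      (if i = 0 then 4 else 0) + 2 * tape (step M c) (2 * i) + tape (step M c) (2 * i + 1)" for i
  proof (cases "i = h div 2")
    case True
    have "tape (step (pair_tm M) c') i = pair_write (h mod 2) v x"
      using del nh hd' True by (simp add: step_def)
    moreover have "tape (step M c) = (tape c)(h := x)"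
      using qxd False by (simp add: step_def h_def)
    ultimately show ?thesis
      using True half unfolding pair_write_def va by (auto simp: a_def b_def)
  next
    case ne: False
    then have "2 * i \<noteq> h" "2 * i + 1 \<noteq> h" by auto
    then show ?thesis using ne del nh hd' qxd False tp by (simp add: step_def h_def)
  qed
  show ?thesis
    using new move_head_pair_move[OF hd v4] del nh qxd False hd'
    by (simp add: pair_rel_def step_def h_def)
qed

lemma paired_input_simps:
  "paired_input [] = []"
  "paired_input (b # bs) = (if b then [1, 0] else [0, 1]) @ paired_input bs"
  by (simp_all add: paired_input_def)

lemma set_paired_input: "set (paired_input w) \<subseteq> {..<2}"
  by (induction w) (auto simp: paired_input_simps)

lemma length_paired_input: "length (paired_input w) = 2 * length w"
  by (induction w) (auto simp: paired_input_simps)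

lemma nth_paired_input:
  assumes "i < length w"
  shows "paired_input w ! (2 * i) = (if w ! i then 1 else 0)"
    and "paired_input w ! Suc (2 * i) = (if w ! i then 0 else 1)"
proof -
  have "paired_input w ! (2 * i) = (if w ! i then 1 else 0) \<and>
      paired_input w ! Suc (2 * i) = (if w ! i then 0 else 1)"
    using assms by (induction w arbitrary: i)
      (auto simp: paired_input_simps nth_Cons split: nat.splits)
  then show "paired_input w ! (2 * i) = (if w ! i then 1 else 0)"
    and "paired_input w ! Suc (2 * i) = (if w ! i then 0 else 1)" by auto
qed

lemma pair_rel_run:
  assumes "turing_machine M" "num_symbols M = 2"
  shows "pair_rel M (run M (paired_input w) n) (run (pair_tm M) (plain_input w) (Suc n))"
proof (induction n)
  case 0
  let ?I = "initial M (paired_input w)" and ?I' = "initial (pair_tm M) (plain_input w)"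
  have initial_pair: "tape ?I' i = 2 * tape ?I (2 * i) + tape ?I (2 * i + 1)" "tape ?I' i < 4" for i
    using nth_paired_input[of i w]
    by (simp_all add: initial_def plain_input_def length_paired_input)
  have "accept M < num_states M" "reject M < num_states M"
    using assms by (auto simp: turing_machine_def)
  then have "\<not> halted (pair_tm M) ?I'"
    by (auto simp: halted_def initial_def pair_tm_def)
  moreover have initial_state: "state ?I = start M" "head ?I = 0" by (simp_all add: initial_def)
  ultimately have "step (pair_tm M) ?I' =
      \<lparr>state = pair_state M (start M) 0, head = 0, tape = (tape ?I')(0 := tape ?I' 0 mod 4 + 4)\<rparr>"
    by (simp add: step_def initial_def pair_tm_def)
  then show ?case
    unfolding run_Suc run_0 pair_rel_def using initial_pair(2)[of 0] initial_pair(1)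
    by (simp add: initial_state)
next
  case (Suc n)
  have "set (paired_input w) \<subseteq> {..<num_symbols M}" using set_paired_input assms by simp
  then show ?case
    using pair_rel_step[OF Suc] run_wellformed[OF assms(1), of "paired_input w" n] assms(2)
    unfolding run_Suc[of M] run_Suc[of "pair_tm M" _ "Suc n"] by simp
qed

lemma DWO_PSPACE_subset_PTIME: "DWO_PSPACE \<subseteq> PTIME"
proof
  fix L assume "L \<in> DWO_PSPACE"
  then obtain M where M: "write_once M" "decides paired_input M L"
    and space: "poly_bounded (\<lambda>w. space_usage M (paired_input w))"
    by (auto simp: DWO_PSPACE_def poly_bounded_def)
  have tm: "turing_machine M" and two: "num_symbols M = 2" using M by (auto simp: write_once_def)
  note rel = pair_rel_run[OF tm two]
  have halt: "halted (pair_tm M) (run (pair_tm M) (plain_input w) (Suc n))"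
    if "halted M (run M (paired_input w) n)" for w n
    using that rel[of w n] by (auto simp: pair_rel_def halted_def pair_state_def pair_tm_def)
  have "\<exists>n. state (run (pair_tm M) (plain_input w) n) =
      (if w \<in> L then accept (pair_tm M) else reject (pair_tm M))" for w
  proof -
    obtain n where "state (run M (paired_input w) n) = (if w \<in> L then accept M else reject M)"
      using M(2) by (auto simp: decides_def)
    then show ?thesis using rel[of w n]
      by (intro exI[of _ "Suc n"]) (auto simp: pair_rel_def pair_state_def pair_tm_def)
  qed
  then have dec: "decides plain_input (pair_tm M) L" unfolding decides_def by blast
  have "poly_bounded (\<lambda>w. running_time (pair_tm M) (plain_input w))"
  proof (rule poly_bounded_mono)
    let ?s = "\<lambda>w. space_usage M (paired_input w)"
    show "poly_bounded (\<lambda>w. num_states M * (?s w * (?s w + 1)) + 1)"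
      by (intro poly_bounded_intros space)
    show "running_time (pair_tm M) (plain_input w) \<le> num_states M * (?s w * (?s w + 1)) + 1" for w
    proof -
      obtain n where n: "halted M (run M (paired_input w) n)" using decides_halts[OF M(2)] by blast
      have "running_time (pair_tm M) (plain_input w) \<le> Suc (running_time M (paired_input w))"
        by (intro running_time_le halt running_time_halted[OF n])
      then show ?thesis
        using write_once_running_time[OF M(1) set_paired_input n] by simp
    qed
  qed
  then show "L \<in> PTIME"
    using turing_machine_pair_tm[OF tm two] dec
    unfolding PTIME_def poly_bounded_def by (intro CollectI exI[of _ "pair_tm M"]) (auto simp: pair_tm_def)
qed

subsection \<open>Bounded views of the tape\<close>

text \<open>
  A configuration is displayed as a state, the reversed tape contents to the left of the head, and
  those from the head onwards. The total length is fixed: a step to the right of the displayed part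
  is undefined, so that a computation displayed in this way comes with a space bound.
\<close>

type_synonym 'q view = "'q \<times> nat list \<times> nat list"

fun view_step :: "('q \<Rightarrow> nat \<Rightarrow> 'q \<times> nat \<times> move) \<Rightarrow> 'q set \<Rightarrow> 'q view \<Rightarrow> 'q view option" where
  "view_step d H (q, l, []) = None"
| "view_step d H (q, l, a # r) =
     (if q \<in> H then None
      else case d q a of (q', b, m) \<Rightarrow>
        (case m of
           Stay \<Rightarrow> Some (q', l, b # r)
         | Right \<Rightarrow> if r = [] then None else Some (q', b # l, r)
         | Left \<Rightarrow> (case l of [] \<Rightarrow> Some (q', [], b # r) | x # l' \<Rightarrow> Some (q', l', x # b # r))))"

definition view_reach ::
  "('q \<Rightarrow> nat \<Rightarrow> 'q \<times> nat \<times> move) \<Rightarrow> 'q set \<Rightarrow> 'q view \<Rightarrow> 'q view \<Rightarrow> bool" where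
  "view_reach d H = (\<lambda>c c'. view_step d H c = Some c')\<^sup>*\<^sup>*"

lemma view_reach_refl [simp, intro]: "view_reach d H c c"
  by (simp add: view_reach_def)

lemma view_reach_trans [trans]:
  "view_reach d H c c' \<Longrightarrow> view_reach d H c' c'' \<Longrightarrow> view_reach d H c c''"
  unfolding view_reach_def by (rule rtranclp_trans)

lemma view_reach_step:
  "view_step d H c = Some c' \<Longrightarrow> view_reach d H c' c'' \<Longrightarrow> view_reach d H c c''"
  unfolding view_reach_def by (rule converse_rtranclp_into_rtranclp)

lemma view_reach_one: "view_step d H c = Some c' \<Longrightarrow> view_reach d H c c'"
  by (rule view_reach_step) auto

lemma view_reach_two:
  "Option.bind (view_step d H c) (view_step d H) = Some c' \<Longrightarrow> view_reach d H c c'"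
  by (auto simp: bind_eq_Some_conv intro: view_reach_step view_reach_one)

section \<open>From views to write-once machines\<close>

definition tape_of :: "nat list \<Rightarrow> nat \<Rightarrow> nat" where
  "tape_of xs i = (if i < length xs then xs ! i else 0)"

fun config_of :: "('q \<Rightarrow> nat) \<Rightarrow> 'q view \<Rightarrow> config" where
  "config_of e (q, l, r) = \<lparr>state = e q, head = length l, tape = tape_of (rev l @ r)\<rparr>"

text \<open>The states of a \<open>tm\<close> are numbers, whereas the control of the queue is
  described by a datatype; \<open>e\<close> is meant to number the finite set \<open>Q\<close> of
  its states.\<close>

definition compile ::
  "('q \<Rightarrow> nat) \<Rightarrow> 'q set \<Rightarrow> ('q \<Rightarrow> nat \<Rightarrow> 'q \<times> nat \<times> move) \<Rightarrow> 'q \<Rightarrow> 'q \<Rightarrow> 'q \<Rightarrow> tm" where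
  "compile e Q d s a r =
     \<lparr>num_states = card Q, num_symbols = 2, start = e s, accept = e a, reject = e r,
      delta = (\<lambda>p x. case d (inv_into Q e p) x of (q, b, m) \<Rightarrow> (e q, b, m))\<rparr>"

text \<open>For symbols below 2 the condition \<open>x \<le> b\<close> on the written symbol is
  exactly the write-once restriction.\<close>

locale finite_control =
  fixes Q :: "'q set" and d :: "'q \<Rightarrow> nat \<Rightarrow> 'q \<times> nat \<times> move" and s a r :: 'q
    and e :: "'q \<Rightarrow> nat"
  assumes bij: "bij_betw e Q {..<card Q}"
    and special: "s \<in> Q" "a \<in> Q" "r \<in> Q" "a \<noteq> r"
    and closed: "\<And>q x q' b m. q \<in> Q \<Longrightarrow> x < 2 \<Longrightarrow> d q x = (q', b, m) \<Longrightarrow> q' \<in> Q \<and> x \<le> b \<and> b < 2"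
begin

abbreviation "M \<equiv> compile e Q d s a r"

lemma e_less: "q \<in> Q \<Longrightarrow> e q < card Q"
  using bij by (auto simp: bij_betw_def)

lemma e_eq_iff: "p \<in> Q \<Longrightarrow> q \<in> Q \<Longrightarrow> e p = e q \<longleftrightarrow> p = q"
  using bij by (auto simp: bij_betw_def inj_on_eq_iff)

lemma e_surj: "p \<in> {..<card Q} \<Longrightarrow> \<exists>q\<in>Q. p = e q"
  using bij unfolding bij_betw_def by blast

lemma delta_compile:
  assumes "q \<in> Q" shows "delta M (e q) x = (case d q x of (q', b, m) \<Rightarrow> (e q', b, m))"
  using assms bij by (simp add: compile_def bij_betw_def)

lemma write_once_compile: "write_once M"
proof -
  have *: "q' < card Q \<and> x \<le> b \<and> b < 2" if p: "p < card Q" "x < 2" and del: "delta M p x = (q', b, m)"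
    for p x q' b m
  proof -
    obtain q where q: "q \<in> Q" "p = e q" using e_surj[of p] p(1) by blast
    obtain q1 b1 m1 where d1: "d q x = (q1, b1, m1)" by (metis prod_cases3)
    then show ?thesis using closed[OF q(1) p(2) d1] del q e_less by (auto simp: delta_compile)
  qed
  have "turing_machine M"
    unfolding turing_machine_def
  proof (intro conjI allI impI)
    fix p x q' b m assume "p < num_states M" "x < num_symbols M" "delta M p x = (q', b, m)"
    then show "q' < num_states M" "b < num_symbols M"
      using *[of p x q' b m] by (simp_all add: compile_def)
  qed (use special e_less e_eq_iff in \<open>simp_all add: compile_def\<close>)
  moreover have "b \<noteq> 0" if "p < num_states M" "delta M p 1 = (q', b, m)" for p q' b m
    using *[of p 1 q' b m] that by (simp add: compile_def)
  ultimately show ?thesis unfolding write_once_def by (auto simp: compile_def)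
qed

definition view_in :: "nat \<Rightarrow> 'q view \<Rightarrow> bool" where
  "view_in n c \<longleftrightarrow> (case c of (q, xs, ys) \<Rightarrow>
     q \<in> Q \<and> set xs \<subseteq> {..<2} \<and> set ys \<subseteq> {..<2} \<and> ys \<noteq> [] \<and> length xs + length ys = n)"

lemma view_step_compile:
  assumes st: "view_step d {a, r} c = Some c'" and inside: "view_in n c"
  shows "step M (config_of e c) = config_of e c'" and "view_in n c'"
proof -
  obtain q l x ys where c: "c = (q, l, x # ys)" using st
    by (metis view_step.elims option.distinct(1))
  have q: "q \<in> Q" "x < 2" "q \<noteq> a" "q \<noteq> r"
    using st inside by (auto simp: c view_in_def split: if_splits)
  obtain q' b m where d: "d q x = (q', b, m)" by (metis prod_cases3)
  have q': "q' \<in> Q" "b < 2" using closed[OF q(1,2) d] by auto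
  have nh: "\<not> halted M (config_of e c)"
    using q special e_eq_iff by (auto simp: halted_def c compile_def)
  have tp: "(tape_of (rev l @ x # ys))(length l := b) = tape_of (rev l @ b # ys)"
    by (auto simp: tape_of_def fun_eq_iff nth_append nth_Cons split: nat.splits)
  have rd: "tape_of (rev l @ x # ys) (length l) = x"
    by (simp add: tape_of_def nth_append)
  have "step M (config_of e c) =
      \<lparr>state = e q', head = move_head m (length l), tape = tape_of (rev l @ b # ys)\<rparr>"
    using nh q(1) d by (simp add: step_def c rd tp delta_compile)
  moreover have "\<dots> = config_of e c' \<and> view_in n c'"
    using st q q' d inside by (cases m) (auto simp: c view_in_def split: list.splits if_splits)
  ultimately show "step M (config_of e c) = config_of e c'" and "view_in n c'" by auto
qed

lemma view_reach_compile:
  assumes "view_reach d {a, r} c c'" and "view_in n c"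
  shows "\<exists>t. (step M ^^ t) (config_of e c) = config_of e c' \<and> view_in n c' \<and>
    (\<forall>i\<le>t. head ((step M ^^ i) (config_of e c)) < n)"
  using assms(1) unfolding view_reach_def
proof (induction rule: rtranclp_induct)
  case base
  then show ?case using assms(2) by (intro exI[of _ 0]) (auto simp: view_in_def)
next
  case (step c1 c2)
  then obtain t where t: "(step M ^^ t) (config_of e c) = config_of e c1" "view_in n c1"
    "\<forall>i\<le>t. head ((step M ^^ i) (config_of e c)) < n" by blast
  have c2: "step M (config_of e c1) = config_of e c2" "view_in n c2"
    using view_step_compile[OF step.hyps(2) t(2)] by auto
  then have "head (config_of e c2) < n" by (auto simp: view_in_def)
  then show ?case using t c2
    by (intro exI[of _ "Suc t"]) (auto simp: le_Suc_eq)
qed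

text \<open>The blanks \<open>replicate p 0\<close> are the space granted in advance. After halting
  the head stands still, so the length of the view bounds it at all times.\<close>

lemma space_usage_compile:
  assumes "view_reach d {a, r} (s, [], xs @ replicate p 0) (q, l', r')"
    and "q = a \<or> q = r" and "set xs \<subseteq> {..<2}" and "length xs + p > 0"
  shows "\<exists>t. state (run M xs t) = e q" and "space_usage M xs \<le> length xs + p"
proof -
  let ?n = "length xs + p"
  have init: "config_of e (s, [], xs @ replicate p 0) = initial M xs"
    by (auto simp: initial_def compile_def tape_of_def fun_eq_iff nth_append)
  have "view_in ?n (s, [], xs @ replicate p 0)"
    using assms special by (auto simp: view_in_def)
  from view_reach_compile[OF assms(1) this]
  obtain t where t: "run M xs t = config_of e (q, l', r')" "\<forall>i\<le>t. head (run M xs i) < ?n"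
    by (auto simp: init run_def simp del: config_of.simps)
  then show "\<exists>t. state (run M xs t) = e q" by (intro exI[of _ t]) simp
  have "halted M (run M xs t)" using t(1) assms(2) by (auto simp: halted_def compile_def)
  then have "run M xs i = run M xs t" if "t \<le> i" for i using that by (rule run_halted)
  then have "head (run M xs i) < ?n" for i using t(2) by (metis nat_le_linear order_refl)
  then have "visited_cells M xs \<subseteq> {..<?n}" by (auto simp: visited_cells_def)
  then show "space_usage M xs \<le> ?n"
    unfolding space_usage_def using card_mono[of "{..<?n}"] by fastforce
qed

end

subsection \<open>Queues on a write-once tape\<close>

text \<open>
  What to do after appending a word to the tape: recode further input bits, or pop the next symbol
  of the queue, the last two popped symbols being \<open>x\<close> and \<open>y\<close>.
\<close>

datatype ctl = Recode | Queue nat nat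

text \<open>The flag of the \<open>Fetch\<close> states tells whether the first input block is being
  read. The lists are words still to be written, \<open>PairFst b\<close> remembers the right half
  of a block, \<open>Rewind j\<close> waits for \<open>j\<close> more marks in a row, and
  \<open>Count j\<close> has read \<open>j\<close> marks of the popped code.\<close>

datatype ctrl_state =
    Accept | Reject
  | Fetch bool | FetchTrue bool | FetchFalse bool
  | Skip "nat list" | SkipOne "nat list" | SkipZero "nat list"
  | Seek "nat list" ctl | SeekZero "nat list" ctl | Put "nat list" ctl
  | Back | BackZero | PairLeft | PairSnd | PairFst nat | PairFound
  | Rewind nat nat nat | Forward nat nat | Count nat nat nat

text \<open>With \<open>Suc a\<close> instead of \<open>a\<close> every code contains a mark, so two
  adjacent blanks occur only beyond the last code.\<close>

definition code :: "nat \<Rightarrow> nat list" where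
  "code a = 0 # replicate (Suc a) 1"

definition codes :: "nat list \<Rightarrow> nat list" where
  "codes xs = concat (map code xs)"

lemma codes_simps [simp]:
  "codes [] = []" "codes (x # xs) = code x @ codes xs" "codes (xs @ ys) = codes xs @ codes ys"
  by (simp_all add: codes_def)

lemma set_codes: "set (codes xs) \<subseteq> {0, 1}"
  by (auto simp: codes_def code_def)

lemma length_code [simp]: "length (code a) = a + 2"
  by (simp add: code_def)

lemma length_codes_le: "set xs \<subseteq> {..<K} \<Longrightarrow> length (codes xs) \<le> length xs * (K + 1)"
  by (induction xs) auto

lemma codes_Cons: "xs \<noteq> [] \<Longrightarrow> codes xs = 0 # tl (codes xs)"
  by (cases xs) (auto simp: code_def)

text \<open>Three consecutively popped symbols \<open>x\<close>, \<open>y\<close>, \<open>z\<close>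
  give a cell with both neighbours, enough for a local transition rule. The length 3 is attained at
  the end of a pass, where two cells and the separator are appended; the bound keeps the control
  finite. The flag of \<open>inp\<close> singles out the first input bit.\<close>

locale queue_machine =
  fixes K :: nat and out :: "nat \<Rightarrow> nat \<Rightarrow> nat \<Rightarrow> nat list" and verdict :: "nat \<Rightarrow> bool option"
    and inp :: "bool \<Rightarrow> bool \<Rightarrow> nat" and sep :: nat and nil_answer :: bool
  assumes out: "\<And>x y z. x < K \<Longrightarrow> y < K \<Longrightarrow> z < K \<Longrightarrow> set (out x y z) \<subseteq> {..<K} \<and> length (out x y z) \<le> 3"
    and inp: "\<And>f b. inp f b < K" and sep: "sep < K"
begin

text \<open>
  Input blocks are consumed from the left by overwriting them with 11, while the codes of the
  input symbols grow to the right of the first block 00. When that block is reached, it is overwritten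
  too, so that the queue is preceded by marks only.

  In the states \<open>Seek\<close>, \<open>SeekZero\<close>, \<open>Put\<close> the end of the written part is recognized by two successive
  blanks, the first of which is already the leading 0 of the word to be appended; this is why these states
  carry a code without its head. \<open>Rewind\<close> looks for \<open>K + 1\<close> successive marks, which no code contains.
  The empty word is decided outright, since the queue would hold no cell.
\<close>

definition answer :: "bool \<Rightarrow> ctrl_state" where
  "answer b = (if b then Accept else Reject)"

fun wdelta :: "ctrl_state \<Rightarrow> nat \<Rightarrow> ctrl_state \<times> nat \<times> move" where
  "wdelta Accept a = (Accept, a, Stay)"
| "wdelta Reject a = (Reject, a, Stay)"
| "wdelta (Fetch f) a = (if a = 1 then FetchTrue f else FetchFalse f, 1, Right)"
| "wdelta (FetchTrue f) a = (Skip (tl (code (inp f True))), 1, Right)"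
| "wdelta (FetchFalse f) a =
     (if a = 1 then (Skip (tl (code (inp f False))), 1, Right)
      else if f then (answer nil_answer, a, Stay)
      else (Seek (tl (code sep)) (Queue sep sep), 1, Right))"
| "wdelta (Skip w) a = (if a = 1 then SkipOne w else SkipZero w, a, Right)"
| "wdelta (SkipOne w) a = (Skip w, a, Right)"
| "wdelta (SkipZero w) a = (if a = 1 then Skip w else Seek w Recode, a, Right)"
| "wdelta (Seek w c) a = (if a = 1 then Seek w c else SeekZero w c, a, Right)"
| "wdelta (SeekZero w c) a = (if a = 1 then (Seek w c, a, Right) else (Put w c, a, Stay))"
| "wdelta (Put [] Recode) a = (Back, a, Stay)"
| "wdelta (Put [] (Queue x y)) a = (Rewind (K + 1) x y, a, Stay)"
| "wdelta (Put (b # w) c) a = (Put w c, max a b, Right)"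
| "wdelta Back a = (if a = 1 then Back else BackZero, a, Left)"
| "wdelta BackZero a = (if a = 1 then Back else PairLeft, a, Left)"
| "wdelta PairLeft a = (PairSnd, a, Left)"
| "wdelta PairSnd a = (PairFst a, a, Left)"
| "wdelta (PairFst b) a = (if a = 1 \<and> b = 1 then (PairFound, a, Right) else (PairLeft, a, Stay))"
| "wdelta PairFound a = (Fetch False, a, Right)"
| "wdelta (Rewind 0 x y) a = (Forward x y, a, Stay)"
| "wdelta (Rewind (Suc j) x y) a = (Rewind (if a = 1 then j else K + 1) x y, a, Left)"
| "wdelta (Forward x y) a = (if a = 1 then Forward x y else Count 0 x y, 1, Right)"
| "wdelta (Count j x y) a =
     (if a = 1 then (if j < K then Count (Suc j) x y else Reject, a, Right)
      else case verdict (j - 1) of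
        Some b \<Rightarrow> (answer b, a, Stay)
      | None \<Rightarrow>
          (if out x y (j - 1) = [] then Rewind (K + 1) y (j - 1)
           else Seek (tl (codes (out x y (j - 1)))) (Queue y (j - 1)), a, Stay))"

abbreviation reach :: "ctrl_state view \<Rightarrow> ctrl_state view \<Rightarrow> bool" (infix "\<leadsto>" 50) where
  "c \<leadsto> c' \<equiv> view_reach wdelta {Accept, Reject} c c'"

abbreviation view :: "ctrl_state \<Rightarrow> nat list \<Rightarrow> nat list \<Rightarrow> ctrl_state view" where
  "view q l r \<equiv> (q, rev l, r)"

section \<open>Appending, rewinding and popping\<close>

lemma Seek_ones:
  "r \<noteq> [] \<Longrightarrow> view (Seek w c) l (replicate n 1 @ r) \<leadsto> view (Seek w c) (l @ replicate n 1) r"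
proof (induction n arbitrary: l)
  case (Suc n)
  show ?case
    by (rule view_reach_step) (use Suc.prems Suc.IH[of "l @ [1]"] in simp_all)
qed simp

lemma Seek_codes:
  "r \<noteq> [] \<Longrightarrow> view (Seek w c) l (codes xs @ r) \<leadsto> view (Seek w c) (l @ codes xs) r"
proof (induction xs arbitrary: l)
  case (Cons x xs)
  have "view (Seek w c) l (codes (x # xs) @ r) \<leadsto>
      view (Seek w c) (l @ [0, 1]) (replicate x 1 @ codes xs @ r)"
    by (rule view_reach_two) (simp add: code_def Cons.prems)
  also have "\<dots> \<leadsto> view (Seek w c) ((l @ [0, 1]) @ replicate x 1) (codes xs @ r)"
    using Cons.prems by (intro Seek_ones) simp
  also have "\<dots> \<leadsto> view (Seek w c) (l @ codes (x # xs)) r"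
    using Cons.IH[of "((l @ [0, 1]) @ replicate x 1)"] Cons.prems by (simp add: code_def)
  finally show ?case .
qed simp

lemma Put_word:
  "r \<noteq> [] \<Longrightarrow> view (Put w c) l (replicate (length w) 0 @ r) \<leadsto> view (Put [] c) (l @ w) r"
proof (induction w arbitrary: l)
  case (Cons b w)
  show ?case
    by (rule view_reach_step) (use Cons.prems Cons.IH[of "l @ [b]"] in simp_all)
qed simp

text \<open>At least one blank beyond the appended word is displayed, since the head comes to rest
  there.\<close>

lemma push:
  assumes "ys \<noteq> []"
  shows "view (Seek (tl (codes ys)) c) l (codes xs @ replicate (length (codes ys) + Suc p) 0) \<leadsto>
    view (Put [] c) (l @ codes xs @ codes ys) (replicate (Suc p) 0)"
proof -
  define w where "w = tl (codes ys)"
  have w: "codes ys = 0 # w" using codes_Cons[OF assms] by (simp add: w_def)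
  have "w \<noteq> []" using assms w by (cases ys) (auto simp: code_def)
  then obtain m where m: "length w = Suc m" by (cases w) auto
  have "view (Seek w c) l (codes xs @ replicate (length (codes ys) + Suc p) 0) \<leadsto>
      view (Seek w c) (l @ codes xs) (replicate (length (codes ys) + Suc p) 0)"
    by (intro Seek_codes) simp
  also have "\<dots> \<leadsto> view (Put w c) (l @ codes xs @ [0]) (replicate (length w) 0 @ replicate (Suc p) 0)"
    by (rule view_reach_two) (simp add: w m replicate_add replicate_app_Cons_same)
  also have "\<dots> \<leadsto> view (Put [] c) ((l @ codes xs @ [0]) @ w) (replicate (Suc p) 0)"
    by (intro Put_word) simp
  finally show ?thesis by (simp add: w)
qed

lemma Forward_ones:
  "view (Forward x y) l (replicate n 1 @ 0 # r) \<leadsto> view (Forward x y) (l @ replicate n 1) (0 # r)"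
proof (induction n arbitrary: l)
  case (Suc n)
  show ?case
    by (rule view_reach_step) (use Suc.IH[of "l @ [1]"] in simp_all)
qed simp

lemma Rewind_ones:
  assumes "n \<le> k"
  shows "view (Rewind (Suc k) x y) (l @ replicate n 1) (1 # r) \<leadsto>
    view (Rewind (Suc k - n) x y) l (replicate n 1 @ 1 # r)"
  using assms
proof (induction n arbitrary: r k)
  case (Suc n)
  then obtain k' where k: "k = Suc k'" by (cases k) auto
  have "view (Rewind (Suc k) x y) (l @ replicate (Suc n) 1) (1 # r) \<leadsto>
      view (Rewind (Suc k') x y) (l @ replicate n 1) (1 # 1 # r)"
    by (rule view_reach_one) (simp add: k replicate_app_Cons_same)
  also have "\<dots> \<leadsto> view (Rewind (Suc k' - n) x y) l (replicate n 1 @ 1 # 1 # r)"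
    using Suc by (intro Suc.IH) (simp add: k)
  finally show ?case
    by (simp add: k replicate_app_Cons_same)
qed simp

text \<open>At the left end of the tape the machine reads the same symbol 1 again and again.\<close>

lemma Rewind_prefix:
  "view (Rewind j x y) (replicate p 1) (1 # replicate n 1 @ 0 # r) \<leadsto>
    view (Forward x y) (replicate (p + Suc n) 1) (0 # r)"
proof (induction j arbitrary: p n)
  case 0
  have "view (Rewind 0 x y) (replicate p 1) (1 # replicate n 1 @ 0 # r) \<leadsto>
      view (Forward x y) (replicate p 1) (replicate (Suc n) 1 @ 0 # r)"
    by (rule view_reach_one) simp
  also have "\<dots> \<leadsto> view (Forward x y) (replicate p 1 @ replicate (Suc n) 1) (0 # r)"
    by (rule Forward_ones)
  finally show ?case by (simp only: replicate_add)
next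
  case (Suc j)
  show ?case
  proof (cases p)
    case 0
    show ?thesis by (rule view_reach_step) (use 0 Suc.IH[of 0 n] in simp_all)
  next
    case (Suc p')
    have "view (Rewind (Suc j) x y) (replicate p 1) (1 # replicate n 1 @ 0 # r) \<leadsto>
        view (Rewind j x y) (replicate p' 1) (1 # replicate (Suc n) 1 @ 0 # r)"
      by (rule view_reach_one) (simp add: Suc replicate_app_Cons_same)
    also have "\<dots> \<leadsto> view (Forward x y) (replicate (p' + Suc (Suc n)) 1) (0 # r)"
      by (rule Suc.IH)
    finally show ?thesis by (simp add: Suc)
  qed
qed

text \<open>A 0 resets the counter to \<open>K + 1\<close>, and the code of \<open>z < K\<close> has
  only \<open>z + 1\<close> marks, so the counter is still positive at its leading 0; hence the
  induction for arbitrary \<open>Suc j\<close>. As \<open>N \<ge> 1\<close>, a mark follows on the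
  left of all codes, where \<open>Rewind_prefix\<close> takes over.\<close>

lemma Rewind_codes:
  assumes "set xs \<subseteq> {..<K}" "N \<ge> 1"
  shows "view (Rewind (Suc j) x y) (replicate N 1 @ codes xs) (0 # r) \<leadsto>
    view (Forward x y) (replicate N 1) (codes xs @ 0 # r)"
  using assms(1)
proof (induction xs arbitrary: j r rule: rev_induct)
  case Nil
  obtain N' where N: "N = Suc N'" using assms(2) by (cases N) auto
  have "view (Rewind (Suc j) x y) (replicate N 1) (0 # r) \<leadsto>
      view (Rewind (K + 1) x y) (replicate N' 1) (1 # replicate 0 1 @ 0 # r)"
    by (rule view_reach_one) (simp add: N replicate_append_same)
  also have "\<dots> \<leadsto> view (Forward x y) (replicate (N' + Suc 0) 1) (0 # r)"
    by (rule Rewind_prefix)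
  finally show ?case by (simp add: N)
next
  case (snoc z zs)
  let ?l = "replicate N 1 @ codes zs"
  have z: "z < K" using snoc.prems by simp
  then obtain t where t: "K = z + Suc t" by (auto dest: less_imp_Suc_add)
  have "view (Rewind (Suc j) x y) (?l @ code z) (0 # r) \<leadsto>
      view (Rewind (Suc K) x y) ((?l @ [0]) @ replicate z 1) (1 # 0 # r)"
    by (rule view_reach_one) (simp add: code_def replicate_app_Cons_same)
  also have "\<dots> \<leadsto> view (Rewind (Suc K - z) x y) (?l @ [0]) (replicate z 1 @ 1 # 0 # r)"
    using z by (intro Rewind_ones) simp
  also have "Suc K - z = Suc (Suc t)" using t by simp
  also have "view (Rewind (Suc (Suc t)) x y) (?l @ [0]) (replicate z 1 @ 1 # 0 # r) \<leadsto>
      view (Rewind (Suc t) x y) ?l (0 # replicate z 1 @ 1 # 0 # r)"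
    by (rule view_reach_one) (cases z; simp)
  also have "\<dots> \<leadsto> view (Forward x y) (replicate N 1) (codes zs @ 0 # replicate z 1 @ 1 # 0 # r)"
    using snoc.prems by (intro snoc.IH) simp
  finally show ?case by (simp add: code_def replicate_app_Cons_same)
qed

lemma Count_ones:
  "j + n \<le> K \<Longrightarrow>
    view (Count j x y) l (replicate n 1 @ 0 # r) \<leadsto> view (Count (j + n) x y) (l @ replicate n 1) (0 # r)"
proof (induction n arbitrary: j l)
  case (Suc n)
  show ?case
    by (rule view_reach_step) (use Suc.prems Suc.IH[of "Suc j" "l @ [1]"] in simp_all)
qed simp

abbreviation queue_view :: "nat \<Rightarrow> nat \<Rightarrow> nat \<Rightarrow> nat list \<Rightarrow> nat \<Rightarrow> ctrl_state view" where
  "queue_view x y N xs p \<equiv> view (Forward x y) (replicate N 1) (codes xs @ replicate p 0)"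

lemma codes_pad_Cons: "\<exists>r. codes xs @ replicate (Suc p) 0 = 0 # r"
  by (cases xs) (auto simp: code_def)

text \<open>Marking the leading 0 merges the whole code, that is \<open>z + 2\<close> cells, into
  the block of marks.\<close>

lemma pop:
  assumes "z < K"
  shows "queue_view x y N (z # zs) (Suc p) \<leadsto>
    view (Count (Suc z) x y) (replicate (N + z + 2) 1) (codes zs @ replicate (Suc p) 0)"
proof -
  obtain r where r: "codes zs @ replicate (Suc p) 0 = 0 # r" using codes_pad_Cons by blast
  have "queue_view x y N (z # zs) (Suc p) \<leadsto>
      view (Count 0 x y) (replicate N 1 @ [1]) (replicate (Suc z) 1 @ 0 # r)"
    by (rule view_reach_one) (use r in \<open>simp add: code_def\<close>)
  also have "\<dots> \<leadsto> view (Count (0 + Suc z) x y) ((replicate N 1 @ [1]) @ replicate (Suc z) 1) (0 # r)"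
    using assms by (intro Count_ones) simp
  also have "(replicate N 1 @ [1]) @ replicate (Suc z) 1 = replicate (N + z + 2) (1::nat)"
    by (simp add: replicate_add[symmetric] replicate_append_same flip: replicate_Suc)
  finally show ?thesis by (simp only: r add_0)
qed

text \<open>The trailing blanks serve as a budget from which every appended code takes its length;
  this is how space is accounted for.\<close>

lemma queue_step:
  assumes "z < K" "x < K" "y < K" "set zs \<subseteq> {..<K}" "zs @ out x y z \<noteq> []" "verdict z = None"
  shows "queue_view x y N (z # zs) (length (codes (out x y z)) + Suc p) \<leadsto>
    queue_view y z (N + z + 2) (zs @ out x y z) (Suc p)"
proof -
  let ?N = "N + z + 2" and ?o = "out x y z"
  obtain r where r: "codes zs @ replicate (length (codes ?o) + Suc p) 0 = 0 # r"
    using codes_pad_Cons[of zs "length (codes ?o) + p"] by auto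
  have o: "set ?o \<subseteq> {..<K}" using out assms by blast
  have "queue_view x y N (z # zs) (length (codes ?o) + Suc p) \<leadsto>
      view (Count (Suc z) x y) (replicate ?N 1) (0 # r)"
    using pop[OF assms(1), of x y N zs "length (codes ?o) + p"] by (simp only: r[unfolded add_Suc_right] add_Suc_right)
  also have "\<dots> \<leadsto> queue_view y z ?N (zs @ ?o) (Suc p)"
  proof (cases "?o = []")
    case True
    have "view (Count (Suc z) x y) (replicate ?N 1) (0 # r) \<leadsto>
        view (Rewind (Suc K) y z) (replicate ?N 1 @ codes []) (0 # r)"
      by (rule view_reach_one) (simp add: True assms)
    also have "\<dots> \<leadsto> view (Forward y z) (replicate ?N 1) (codes [] @ 0 # r)"
      by (rule Rewind_codes) simp_all
    finally show ?thesis using r True by simp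
  next
    case False
    have "view (Count (Suc z) x y) (replicate ?N 1) (0 # r) \<leadsto>
        view (Seek (tl (codes ?o)) (Queue y z)) (replicate ?N 1)
          (codes zs @ replicate (length (codes ?o) + Suc p) 0)"
      by (rule view_reach_one) (use r in \<open>simp add: False assms\<close>)
    also have "\<dots> \<leadsto> view (Put [] (Queue y z)) (replicate ?N 1 @ codes zs @ codes ?o) (replicate (Suc p) 0)"
      by (rule push[OF False])
    also have "\<dots> \<leadsto> view (Rewind (Suc K) y z) (replicate ?N 1 @ codes (zs @ ?o)) (0 # replicate p 0)"
      by (rule view_reach_one) simp
    also have "\<dots> \<leadsto> view (Forward y z) (replicate ?N 1) (codes (zs @ ?o) @ 0 # replicate p 0)"
      using assms o by (intro Rewind_codes) simp_all
    finally show ?thesis by simp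
  qed
  finally show ?thesis .
qed

lemma queue_halt:
  assumes "z < K" "verdict z = Some b"
  shows "\<exists>l r. queue_view x y N (z # zs) (Suc p) \<leadsto> (answer b, l, r)"
proof -
  obtain r where r: "codes zs @ replicate (Suc p) 0 = 0 # r" using codes_pad_Cons by blast
  have "queue_view x y N (z # zs) (Suc p) \<leadsto>
      view (Count (Suc z) x y) (replicate (N + z + 2) 1) (0 # r)"
    using pop[OF assms(1), of x y N zs p] by (simp only: r)
  also have "\<dots> \<leadsto> view (answer b) (replicate (N + z + 2) 1) (0 # r)"
    by (rule view_reach_one) (simp add: assms)
  finally show ?thesis by blast
qed


section \<open>Recoding the input into the queue\<close>

lemma paired_input_append: "paired_input (xs @ ys) = paired_input xs @ paired_input ys"
  by (simp add: paired_input_def)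

text \<open>Reading two cells at a time is essential: the bits 1, 0 give the cells 1001, which
  contain an unaligned 00.\<close>

lemma Skip_pairs:
  assumes "r \<noteq> []"
  shows "view (Skip w) l (paired_input bs @ 0 # 0 # r) \<leadsto>
    view (Seek w Recode) (l @ paired_input bs @ [0, 0]) r"
proof (induction bs arbitrary: l)
  case Nil
  show ?case by (rule view_reach_two) (simp add: assms paired_input_simps)
next
  case (Cons b bs)
  have "view (Skip w) l (paired_input (b # bs) @ 0 # 0 # r) \<leadsto>
      view (Skip w) (l @ paired_input [b]) (paired_input bs @ 0 # 0 # r)"
    by (rule view_reach_two) (simp add: paired_input_simps)
  also have "\<dots> \<leadsto> view (Seek w Recode) (l @ paired_input (b # bs) @ [0, 0]) r"
    using Cons[of "l @ paired_input [b]"] by (simp add: paired_input_simps)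
  finally show ?case .
qed

lemma Back_ones:
  "view Back (l @ x # replicate n 1) (1 # r) \<leadsto> view Back l (x # replicate n 1 @ 1 # r)"
proof (induction n arbitrary: r)
  case 0
  show ?case by (rule view_reach_one) simp
next
  case (Suc n)
  have "view Back (l @ x # replicate (Suc n) 1) (1 # r) \<leadsto> view Back (l @ x # replicate n 1) (1 # 1 # r)"
    by (rule view_reach_one) (simp add: replicate_app_Cons_same)
  also have "\<dots> \<leadsto> view Back l (x # replicate n 1 @ 1 # 1 # r)" by (rule Suc.IH)
  finally show ?case by (simp add: replicate_app_Cons_same)
qed

text \<open>Every code ends in a mark, so on the way left the first two adjacent zeros are the
  leading 0 of the first code (or the blank, if \<open>ys\<close> is empty) and the right half of
  the delimiter. The head ends on the left half, aligned with the blocks.\<close>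

lemma Back_codes:
  "view Back (l @ 0 # 0 # codes ys) (0 # r) \<leadsto> view PairLeft l (0 # 0 # codes ys @ 0 # r)"
proof (induction ys arbitrary: r rule: rev_induct)
  case Nil
  show ?case by (rule view_reach_two) simp
next
  case (snoc z zs)
  let ?l = "l @ 0 # 0 # codes zs"
  have "view Back (?l @ code z) (0 # r) \<leadsto> view Back ?l (code z @ 0 # r)"
  proof (cases z)
    case 0
    show ?thesis by (rule view_reach_two) (simp add: code_def 0)
  next
    case (Suc m)
    have "view Back (?l @ code z) (0 # r) \<leadsto> view Back (?l @ 0 # replicate m 1) (1 # 1 # 0 # r)"
      by (rule view_reach_two) (simp add: code_def Suc replicate_app_Cons_same)
    also have "\<dots> \<leadsto> view Back ?l (0 # replicate m 1 @ 1 # 1 # 0 # r)" by (rule Back_ones)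
    finally show ?thesis by (simp add: code_def Suc replicate_app_Cons_same)
  qed
  also have "\<dots> \<leadsto> view PairLeft l (0 # 0 # codes zs @ code z @ 0 # r)"
    using snoc.IH[of "replicate (Suc z) 1 @ 0 # r"] by (simp add: code_def)
  finally show ?case by simp
qed

text \<open>Alignment matters again, as the bits 0, 1 give 0110. The prefix of \<open>N + 2\<close>
  marks ends in the block 11 of the bit just consumed, which stops the search.\<close>

lemma PairLeft_pairs:
  "view PairLeft (replicate (N + 2) 1 @ paired_input bs) (a # r) \<leadsto>
    view (Fetch False) (replicate (N + 2) 1) (paired_input bs @ a # r)"
proof (induction bs arbitrary: a r rule: rev_induct)
  case Nil
  let ?l = "replicate N 1 :: nat list"
  have "view PairLeft (replicate (N + 2) 1) (a # r) \<leadsto> view (PairFst 1) ?l (1 # 1 # a # r)"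
    by (rule view_reach_two) (simp add: replicate_app_Cons_same replicate_append_same)
  also have "\<dots> \<leadsto> view (Fetch False) (replicate (N + 2) 1) (a # r)"
    by (rule view_reach_two) (simp add: replicate_app_Cons_same replicate_append_same)
  finally show ?case by (simp add: paired_input_simps)
next
  case (snoc b bs)
  let ?l = "replicate (N + 2) 1 @ paired_input bs"
  obtain u v where b: "paired_input [b] = [u, v]" "\<not> (u = 1 \<and> v = 1)"
    by (cases b) (auto simp: paired_input_simps)
  have "view PairLeft (?l @ [u, v]) (a # r) \<leadsto> view (PairFst v) ?l (u # v # a # r)"
    by (rule view_reach_two) simp
  also have "\<dots> \<leadsto> view PairLeft ?l (u # v # a # r)"
    by (rule view_reach_one) (use b(2) in simp)
  also have "\<dots> \<leadsto> view (Fetch False) (replicate (N + 2) 1) (paired_input bs @ u # v # a # r)"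
    by (rule snoc.IH)
  finally show ?case by (simp add: paired_input_append b(1))
qed

lemma recode_bit:
  "view (Fetch f) (replicate N 1)
      (paired_input (b # bs) @ 0 # 0 # codes ys @ replicate (length (code (inp f b)) + Suc p) 0) \<leadsto>
    view (Fetch False) (replicate (N + 2) 1)
      (paired_input bs @ 0 # 0 # codes (ys @ [inp f b]) @ replicate (Suc p) 0)"
proof -
  let ?s = "inp f b" and ?N = "replicate (N + 2) 1 :: nat list"
  let ?r = "codes ys @ replicate (length (codes [?s]) + Suc p) 0"
  have "view (Fetch f) (replicate N 1) (paired_input (b # bs) @ 0 # 0 # ?r) \<leadsto>
      view (Skip (tl (codes [?s]))) ?N (paired_input bs @ 0 # 0 # ?r)"
    by (rule view_reach_two) (simp add: paired_input_simps replicate_app_Cons_same)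
  also have "\<dots> \<leadsto> view (Seek (tl (codes [?s])) Recode) (?N @ paired_input bs @ [0, 0]) ?r"
    by (rule Skip_pairs) simp
  also have "\<dots> \<leadsto> view (Put [] Recode) ((?N @ paired_input bs @ [0, 0]) @ codes ys @ codes [?s])
      (replicate (Suc p) 0)"
    by (rule push) simp
  also have "\<dots> \<leadsto> view Back ((?N @ paired_input bs) @ 0 # 0 # codes (ys @ [?s])) (0 # replicate p 0)"
    by (rule view_reach_one) simp
  also have "\<dots> \<leadsto> view PairLeft (?N @ paired_input bs) (0 # 0 # codes (ys @ [?s]) @ 0 # replicate p 0)"
    by (rule Back_codes)
  also have "\<dots> \<leadsto> view (Fetch False) ?N (paired_input bs @ 0 # 0 # codes (ys @ [?s]) @ 0 # replicate p 0)"
    by (rule PairLeft_pairs)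
  finally show ?thesis by simp
qed

lemma recode_bits:
  "view (Fetch False) (replicate N 1)
      (paired_input bs @ 0 # 0 # codes ys @ replicate (length (codes (map (inp False) bs)) + Suc p) 0) \<leadsto>
    view (Fetch False) (replicate (N + 2 * length bs) 1)
      (0 # 0 # codes (ys @ map (inp False) bs) @ replicate (Suc p) 0)"
proof (induction bs arbitrary: N ys)
  case Nil
  then show ?case by (simp add: paired_input_simps)
next
  case (Cons b bs)
  let ?q = "length (codes (map (inp False) bs)) + p"
  have "view (Fetch False) (replicate N 1)
      (paired_input (b # bs) @ 0 # 0 # codes ys @ replicate (length (code (inp False b)) + Suc ?q) 0) \<leadsto>
    view (Fetch False) (replicate (N + 2) 1)
      (paired_input bs @ 0 # 0 # codes (ys @ [inp False b]) @ replicate (Suc ?q) 0)"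
    by (rule recode_bit)
  also have "\<dots> \<leadsto> view (Fetch False) (replicate (N + 2 + 2 * length bs) 1)
      (0 # 0 # codes ((ys @ [inp False b]) @ map (inp False) bs) @ replicate (Suc p) 0)"
    using Cons[of "N + 2" "ys @ [inp False b]"] by (simp only: add_Suc_right)
  finally show ?case by (simp add: add.assoc)
qed

lemma recode_end:
  assumes "set ys \<subseteq> {..<K}"
  shows "view (Fetch False) (replicate N 1) (0 # 0 # codes ys @ replicate (length (code sep) + Suc p) 0) \<leadsto>
    queue_view sep sep (N + 2) (ys @ [sep]) (Suc p)"
proof -
  let ?N = "replicate (N + 2) 1 :: nat list"
  let ?r = "codes ys @ replicate (length (codes [sep]) + Suc p) 0"
  have "view (Fetch False) (replicate N 1) (0 # 0 # ?r) \<leadsto>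
      view (Seek (tl (codes [sep])) (Queue sep sep)) ?N ?r"
    by (rule view_reach_two) (simp add: replicate_app_Cons_same)
  also have "\<dots> \<leadsto> view (Put [] (Queue sep sep)) (?N @ codes ys @ codes [sep]) (replicate (Suc p) 0)"
    by (rule push) simp
  also have "\<dots> \<leadsto> view (Rewind (Suc K) sep sep) (?N @ codes (ys @ [sep])) (0 # replicate p 0)"
    by (rule view_reach_one) simp
  also have "\<dots> \<leadsto> view (Forward sep sep) ?N (codes (ys @ [sep]) @ 0 # replicate p 0)"
    using assms sep by (intro Rewind_codes) simp_all
  finally show ?thesis by simp
qed

fun queue_input :: "bool list \<Rightarrow> nat list" where
  "queue_input [] = [sep]"
| "queue_input (b # bs) = inp True b # map (inp False) bs @ [sep]"

text \<open>The summand 2 pays for the delimiting block 00, which is not part of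
  \<open>paired_input w\<close>.\<close>

lemma recode_input:
  assumes "w \<noteq> []"
  shows "view (Fetch True) [] (paired_input w @ replicate (2 + length (codes (queue_input w)) + Suc p) 0) \<leadsto>
    queue_view sep sep (2 * length w + 2) (queue_input w) (Suc p)"
proof -
  obtain b bs where w: "w = b # bs" using assms by (cases w) auto
  let ?r = "length (code sep) + p"
  let ?q = "length (codes (map (inp False) bs)) + ?r"
  have inp: "inp f b < K" for f b by (rule inp)
  have "view (Fetch True) (replicate 0 1)
      (paired_input (b # bs) @ 0 # 0 # codes [] @ replicate (length (code (inp True b)) + Suc ?q) 0) \<leadsto>
    view (Fetch False) (replicate (0 + 2) 1)
      (paired_input bs @ 0 # 0 # codes ([] @ [inp True b]) @ replicate (Suc ?q) 0)"
    by (rule recode_bit)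
  also have "\<dots> \<leadsto> view (Fetch False) (replicate (0 + 2 + 2 * length bs) 1)
      (0 # 0 # codes (([] @ [inp True b]) @ map (inp False) bs) @ replicate (Suc ?r) 0)"
    using recode_bits[of "0 + 2" bs "[] @ [inp True b]" ?r] by (simp only: add_Suc_right)
  also have "\<dots> \<leadsto> queue_view sep sep (0 + 2 + 2 * length bs + 2)
      ((([] @ [inp True b]) @ map (inp False) bs) @ [sep]) (Suc p)"
    using recode_end[of "([] @ [inp True b]) @ map (inp False) bs" "0 + 2 + 2 * length bs" p] inp
    by (simp only: add_Suc_right) auto
  finally show ?thesis by (simp add: w add.assoc)
qed

lemma empty_input:
  "\<exists>l r. view (Fetch True) [] (replicate (Suc (Suc (Suc p))) 0) \<leadsto> (answer nil_answer, l, r)"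
proof -
  have "view (Fetch True) [] (replicate (Suc (Suc (Suc p))) 0) \<leadsto>
      (answer nil_answer, [1], replicate (Suc (Suc p)) 0)"
    by (rule view_reach_two) simp
  then show ?thesis by blast
qed

text \<open>A symbol below \<open>K\<close> has a code of at most \<open>K + 1\<close> cells, and at
  most three symbols are appended at once.\<close>

definition words :: "nat list set" where
  "words = {w. set w \<subseteq> {..<2} \<and> length w \<le> 3 * (K + 1)}"

definition ctls :: "ctl set" where
  "ctls = insert Recode (\<Union>x\<in>{..<K}. Queue x ` {..<K})"

definition states :: "ctrl_state set" where
  "states = {Accept, Reject, Back, BackZero, PairLeft, PairSnd, PairFound} \<union>
     range Fetch \<union> range FetchTrue \<union> range FetchFalse \<union> PairFst ` {..<2} \<union>
     Skip ` words \<union> SkipOne ` words \<union> SkipZero ` words \<union>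
     (\<Union>w\<in>words. Seek w ` ctls) \<union> (\<Union>w\<in>words. SeekZero w ` ctls) \<union>
     (\<Union>w\<in>words. Put w ` ctls) \<union>
     (\<Union>j\<in>{..K + 1}. \<Union>x\<in>{..<K}. Rewind j x ` {..<K}) \<union>
     (\<Union>x\<in>{..<K}. Forward x ` {..<K}) \<union>
     (\<Union>j\<in>{..K}. \<Union>x\<in>{..<K}. Count j x ` {..<K})"

lemma in_states:
  "Accept \<in> states" "Reject \<in> states" "Back \<in> states" "BackZero \<in> states" "PairLeft \<in> states"
  "PairSnd \<in> states" "PairFound \<in> states" "Fetch f \<in> states" "FetchTrue f \<in> states"
  "FetchFalse f \<in> states" "PairFst b \<in> states \<longleftrightarrow> b < 2"
  "Skip w \<in> states \<longleftrightarrow> w \<in> words" "SkipOne w \<in> states \<longleftrightarrow> w \<in> words"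
  "SkipZero w \<in> states \<longleftrightarrow> w \<in> words"
  "Seek w c \<in> states \<longleftrightarrow> w \<in> words \<and> c \<in> ctls" "SeekZero w c \<in> states \<longleftrightarrow> w \<in> words \<and> c \<in> ctls"
  "Put w c \<in> states \<longleftrightarrow> w \<in> words \<and> c \<in> ctls"
  "Rewind j x y \<in> states \<longleftrightarrow> j \<le> K + 1 \<and> x < K \<and> y < K"
  "Forward x y \<in> states \<longleftrightarrow> x < K \<and> y < K"
  "Count j x y \<in> states \<longleftrightarrow> j \<le> K \<and> x < K \<and> y < K"
  by (simp add: states_def image_iff)+

lemma finite_states: "finite states"
proof -
  have "finite words" unfolding words_def by (rule finite_lists_length_le) simp
  moreover have "finite ctls" by (simp add: ctls_def)
  ultimately show ?thesis by (simp add: states_def)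
qed

lemma ctls_simps: "Recode \<in> ctls" "Queue x y \<in> ctls \<longleftrightarrow> x < K \<and> y < K"
  by (auto simp: ctls_def)

lemma words_Cons: "b # w \<in> words \<Longrightarrow> b < 2 \<and> w \<in> words"
  by (auto simp: words_def)

lemma tl_codes_words:
  assumes "set xs \<subseteq> {..<K}" "length xs \<le> 3"
  shows "tl (codes xs) \<in> words"
proof -
  have "set (tl (codes xs)) \<subseteq> set (codes xs)" by (cases "codes xs") auto
  moreover have "length (codes xs) \<le> length xs * (K + 1)" by (rule length_codes_le[OF assms(1)])
  moreover have "length xs * (K + 1) \<le> 3 * (K + 1)" using assms(2) by (rule mult_le_mono1)
  ultimately show ?thesis using set_codes[of xs] by (force simp: words_def)
qed

lemma tl_code_words: "s < K \<Longrightarrow> tl (code s) \<in> words"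
  using tl_codes_words[of "[s]"] by simp

lemma answer_states: "answer b \<in> states"
  by (simp add: answer_def in_states)

lemma wdelta_closed:
  assumes "q \<in> states" "x < 2" "wdelta q x = (q', b, m)"
  shows "q' \<in> states \<and> x \<le> b \<and> b < 2"
proof -
  have K: "0 < K" using sep by simp
  have x: "x = 0 \<or> x = 1" using assms(2) by auto
  note facts = in_states ctls_simps answer_states tl_code_words inp sep
  show ?thesis
  proof (cases q)
    \<comment> \<open>To be write-once on every symbol, the transition writes
      \<open>max a b\<close>, which is \<open>b\<close> on the blanks crossed in
      \<open>Put_word\<close>.\<close>
    case (Put w c)
    then show ?thesis
      using assms x K by (cases w; cases c) (auto simp: facts dest: words_Cons)
  next
    case (Rewind j u v)
    then show ?thesis using assms x by (cases j) (auto simp: facts)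
  next
    case (Count j u v)
    have uv: "u < K" "v < K" "j \<le> K" using assms Count by (auto simp: facts)
    \<comment> \<open>For \<open>j = 0\<close> the truncated difference is 0, a valid symbol because
      \<open>0 < K\<close>.\<close>
    have j: "j - 1 < K" using uv K by auto
    have o: "tl (codes (out u v (j - 1))) \<in> words"
      using out[OF uv(1,2) j] by (intro tl_codes_words) auto
    show ?thesis
      using assms(3) x uv j o unfolding Count
      by (auto simp: facts split: if_splits option.splits)
  qed (use assms x in \<open>auto simp: facts split: if_splits\<close>)
qed

lemma finite_control_exists: "\<exists>e. finite_control states wdelta (Fetch True) Accept Reject e"
proof -
  obtain e where "bij_betw e states {..<card states}"
    using ex_bij_betw_finite_nat[OF finite_states] by (auto simp: atLeast0LessThan)
  then have "finite_control states wdelta (Fetch True) Accept Reject e"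
    by (rule finite_control.intro) (rule in_states ctrl_state.distinct wdelta_closed; assumption?)+
  then show ?thesis by blast
qed

end

subsection \<open>Turing machines on a queue\<close>

locale simulation =
  fixes M :: tm and nil_answer :: bool
  assumes tm: "turing_machine M" and three: "num_symbols M \<ge> 3"
begin

text \<open>
  A tape symbol \<open>a\<close> under the head in state \<open>q\<close> is represented by \<open>a + k * (q + 1)\<close>, where \<open>k\<close> is the number
  of tape symbols, and by \<open>a\<close> elsewhere.
\<close>

definition mark :: "nat \<Rightarrow> nat" where
  "mark v = v div num_symbols M"

text \<open>The first number above all symbols with a head; its mark is
  \<open>num_states M + 1\<close>, which belongs to no state.\<close>

definition sep :: nat where
  "sep = num_symbols M * (num_states M + 1)"

definition cell :: "config \<Rightarrow> nat \<Rightarrow> nat" where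
  "cell c i = tape c i + (if i = head c then num_symbols M * (state c + 1) else 0)"

definition headed :: "nat \<Rightarrow> bool" where
  "headed v \<longleftrightarrow> 1 \<le> mark v \<and> mark v \<le> num_states M"

definition action :: "nat \<Rightarrow> nat \<times> nat \<times> move" where
  "action v = delta M (mark v - 1) (v mod num_symbols M)"

definition written :: "nat \<Rightarrow> nat" where
  "written v = (if headed v then fst (snd (action v)) else v)"

text \<open>The head mark sent by \<open>v\<close> in direction \<open>m\<close>, ready to be added
  to the symbol of the cell that receives the head.\<close>

definition leaving :: "nat \<Rightarrow> move \<Rightarrow> nat" where
  "leaving v m =
     (if headed v \<and> snd (snd (action v)) = m then num_symbols M * (fst (action v) + 1) else 0)"

text \<open>
  In a configuration at most one of the summands after \<open>written y\<close> is nonzero, and the minimum only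
  caps junk values for arguments that do not come from a configuration. A move to the left from the leftmost
  cell, whose left neighbour is the separator, leaves the head where it is.
\<close>

definition next_cell :: "nat \<Rightarrow> nat \<Rightarrow> nat \<Rightarrow> nat" where
  "next_cell x y z = min sep
     (written y + leaving y Stay + leaving x Right + leaving z Left +
      (if x = sep then leaving y Left else 0))"

text \<open>
  A new cell is appended one symbol late, when its right neighbour is known. Each pass extends the
  configuration by one blank cell.
\<close>

definition out :: "nat \<Rightarrow> nat \<Rightarrow> nat \<Rightarrow> nat list" where
  "out x y z =
     (if y = sep then []
      else if z = sep then [next_cell x y sep, next_cell y 0 sep, sep]
      else [next_cell x y z])"

definition verdict :: "nat \<Rightarrow> bool option" where
  "verdict v =
     (if mark v = accept M + 1 then Some True
      else if mark v = reject M + 1 then Some False else None)"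

definition inp :: "bool \<Rightarrow> bool \<Rightarrow> nat" where
  "inp f b = (if b then 2 else 1) + (if f then num_symbols M * (start M + 1) else 0)"

lemma headed_symbol_less: "a < num_symbols M \<Longrightarrow> q < num_states M \<Longrightarrow> a + num_symbols M * (q + 1) < sep"
proof -
  assume a: "a < num_symbols M" and q: "q < num_states M"
  have "a + num_symbols M * (q + 1) < num_symbols M * (q + 2)" using a by simp
  also have "\<dots> \<le> sep" unfolding sep_def using q by (intro mult_le_mono2) simp
  finally show ?thesis .
qed

lemma next_cell_le: "next_cell x y z \<le> sep"
  by (simp add: next_cell_def)

text \<open>The separator is the largest symbol, hence \<open>K = sep + 1\<close> and codes of at
  most \<open>sep + 2\<close> cells.\<close>

sublocale queue_machine "sep + 1" out verdict inp sep nil_answer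
proof
  show "set (out x y z) \<subseteq> {..<sep + 1} \<and> length (out x y z) \<le> 3" for x y z
    by (simp add: out_def less_Suc_eq_le next_cell_le)
  have "start M < num_states M" using tm by (simp add: turing_machine_def)
  then show "inp f b < sep + 1" for f b
    using headed_symbol_less[of "if b then 2 else 1" "start M"] three
    by (auto simp: inp_def less_Suc_eq_le split: if_splits)
qed simp

notation reach (infix "\<leadsto>" 50)

section \<open>Configurations as queue contents, one pass for each step\<close>

definition well_formed :: "config \<Rightarrow> bool" where
  "well_formed c \<longleftrightarrow> state c < num_states M \<and> (\<forall>i. tape c i < num_symbols M)"

definition cells :: "config \<Rightarrow> nat \<Rightarrow> nat list" where
  "cells c m = map (cell c) [0..<m]"

text \<open>In the queue, the symbol popped before cell 0 is the separator that closed the previous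
  configuration.\<close>

definition before :: "config \<Rightarrow> nat \<Rightarrow> nat" where
  "before c i = (if i = 0 then sep else cell c (i - 1))"

lemma mark_cell:
  assumes "well_formed c"
  shows "mark (cell c i) = (if i = head c then state c + 1 else 0)"
    and "cell c i mod num_symbols M = tape c i"
proof -
  have "tape c i < num_symbols M" using assms by (simp add: well_formed_def)
  then show "mark (cell c i) = (if i = head c then state c + 1 else 0)"
    and "cell c i mod num_symbols M = tape c i"
    unfolding mark_def cell_def by (cases "i = head c"; simp del: mult_Suc_right)+
qed

lemma headed_cell: "well_formed c \<Longrightarrow> headed (cell c i) \<longleftrightarrow> i = head c"
  by (auto simp: headed_def mark_cell well_formed_def)

lemma mark_sep: "mark sep = num_states M + 1" "\<not> headed sep"
  using three by (simp_all add: mark_def sep_def headed_def)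

lemma cell_less: "well_formed c \<Longrightarrow> cell c i < sep"
proof -
  assume c: "well_formed c"
  then have "tape c i + num_symbols M * (state c + 1) < sep"
    by (intro headed_symbol_less) (auto simp: well_formed_def)
  then show ?thesis by (cases "i = head c") (auto simp: cell_def)
qed

lemma before_le: "well_formed c \<Longrightarrow> before c i \<le> sep"
  using cell_less[of c "i - 1"] by (simp add: before_def)

lemma verdict_cell:
  assumes "well_formed c"
  shows "verdict (cell c i) =
    (if i = head c \<and> halted M c then Some (state c = accept M) else None)"
  using assms by (auto simp: verdict_def mark_cell halted_def)

lemma verdict_sep: "verdict sep = None"
  using tm by (simp add: verdict_def mark_sep turing_machine_def)

lemma well_formed_step:
  assumes "well_formed c" shows "well_formed (step M c)"
proof -
  obtain q b d where d: "delta M (state c) (tape c (head c)) = (q, b, d)" by (metis prod_cases3)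
  show ?thesis
    using assms turing_machine_delta[OF tm _ _ d] by (auto simp: well_formed_def step_def d)
qed

text \<open>Serves the final configuration: on a halted one \<open>step\<close> is the identity,
  whereas \<open>next_cell\<close> still applies \<open>delta\<close> near the head. The cells
  rewritten before the head is popped have no head in their neighbourhood and are copied.\<close>

lemma next_cell_idle:
  assumes "well_formed c" "Suc i < head c"
  shows "next_cell (before c i) (cell c i) (cell c (Suc i)) = cell c i"
proof -
  have "\<not> headed (before c i)"
    using assms by (cases i) (simp_all add: before_def mark_sep headed_cell)
  then show ?thesis
    using assms cell_less[OF assms(1), of i]
    by (simp add: next_cell_def leaving_def written_def headed_cell)
qed

text \<open>The right neighbour enters only through \<open>leaving z Left\<close>, so the separator
  may stand in for a blank cell beyond the end.\<close>

lemma next_cell_step: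
  assumes c: "well_formed c" and nh: "\<not> halted M c" and z: "leaving z Left = leaving (cell c (Suc i)) Left"
  shows "next_cell (before c i) (cell c i) z = cell (step M c) i"
proof -
  obtain q b d where d: "delta M (state c) (tape c (head c)) = (q, b, d)" by (metis prod_cases3)
  let ?s = "num_symbols M * (q + 1)"
  have act: "action (cell c (head c)) = (q, b, d)"
    using c d by (simp add: action_def mark_cell)
  have lv: "leaving (cell c j) m = (if j = head c \<and> d = m then ?s else 0)" for j m
    using c act by (auto simp: leaving_def headed_cell)
  have wr: "written (cell c i) = tape (step M c) i"
    using c act nh d by (auto simp: written_def headed_cell step_def) (simp add: cell_def)
  have leaving_sep: "leaving sep m = 0" for m by (simp add: leaving_def mark_sep)
  have lb: "leaving (before c i) Right = (if i = Suc (head c) \<and> d = Right then ?s else 0)"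
    by (cases i) (simp_all add: before_def lv leaving_sep)
  have bh: "before c i = sep \<longleftrightarrow> i = 0"
    using cell_less[OF c, of "i - 1"] by (auto simp: before_def)
  have hd: "head (step M c) = move_head d (head c)" "state (step M c) = q"
    using nh d by (simp_all add: step_def)
  have "written (cell c i) + leaving (cell c i) Stay + leaving (before c i) Right + leaving z Left +
      (if before c i = sep then leaving (cell c i) Left else 0) = cell (step M c) i"
    unfolding cell_def[of "step M c"] hd wr z lv lb bh by (cases d) auto
  \<comment> \<open>The sum is a cell of a well-formed configuration, hence below
    \<open>sep\<close>, and the cap in \<open>next_cell\<close> is inactive.\<close>
  then show ?thesis
    using cell_less[OF well_formed_step[OF c], of i] by (simp add: next_cell_def)
qed

text \<open>The abstract \<open>g\<close> covers two cases: a complete pass produces the cells of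
  the successor, the last pass copies cells up to the halting head. Being one symbol late, the pass
  has appended only \<open>j\<close> cells after popping cell \<open>j\<close>.\<close>

lemma sweep_prefix:
  assumes c: "well_formed c" and x: "x \<le> sep" and m: "j < m"
    and v: "\<And>i. i \<le> j \<Longrightarrow> verdict (cell c i) = None"
    and g: "\<And>i. i < j \<Longrightarrow> next_cell (before c i) (cell c i) (cell c (Suc i)) = g i"
  shows "\<exists>N'. queue_view x sep N (cells c m @ [sep]) (length (codes (map g [0..<j])) + Suc p) \<leadsto>
    queue_view (before c j) (cell c j) N' (map (cell c) [Suc j..<m] @ sep # map g [0..<j]) (Suc p)"
  using m v g
proof (induction j arbitrary: p)
  case 0
  have "cells c m = cell c 0 # map (cell c) [Suc 0..<m]"
    using 0 by (simp add: cells_def upt_conv_Cons)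
  moreover have "queue_view x sep N (cell c 0 # map (cell c) [Suc 0..<m] @ [sep])
      (length (codes (out x sep (cell c 0))) + Suc p) \<leadsto>
    queue_view sep (cell c 0) (N + cell c 0 + 2)
      ((map (cell c) [Suc 0..<m] @ [sep]) @ out x sep (cell c 0)) (Suc p)"
    using 0 x cell_less[OF c] by (intro queue_step) (auto simp: less_Suc_eq)
  moreover have "out x sep (cell c 0) = []" by (simp add: out_def)
  ultimately show ?case by (intro exI[of _ "N + cell c 0 + 2"]) (simp add: before_def)
next
  case (Suc j)
  let ?R = "map (cell c) [Suc (Suc j)..<m]"
  let ?q = "length (code (g j)) + p"
  obtain N' where "queue_view x sep N (cells c m @ [sep]) (length (codes (map g [0..<j])) + Suc ?q) \<leadsto>
      queue_view (before c j) (cell c j) N' (map (cell c) [Suc j..<m] @ sep # map g [0..<j]) (Suc ?q)"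
    using Suc.IH[of ?q] Suc.prems by auto
  moreover have o: "out (before c j) (cell c j) (cell c (Suc j)) = [g j]"
    using cell_less[OF c, of j] cell_less[OF c, of "Suc j"] Suc.prems(3)[of j] by (simp add: out_def)
  have gK: "g i < sep + 1" if "i < Suc j" for i
    using Suc.prems(3)[OF that] next_cell_le[of "before c i" "cell c i" "cell c (Suc i)"] by simp
  have "queue_view (before c j) (cell c j) N' (cell c (Suc j) # ?R @ sep # map g [0..<j])
      (length (codes (out (before c j) (cell c j) (cell c (Suc j)))) + Suc p) \<leadsto>
    queue_view (cell c j) (cell c (Suc j)) (N' + cell c (Suc j) + 2)
      ((?R @ sep # map g [0..<j]) @ out (before c j) (cell c j) (cell c (Suc j))) (Suc p)"
    using Suc.prems(2)[of "Suc j"] before_le[OF c, of j] cell_less[OF c] gK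
    by (intro queue_step) (auto simp: less_Suc_eq le_less)
  moreover have "map (cell c) [Suc j..<m] = cell c (Suc j) # ?R"
    using Suc.prems(1) by (simp add: upt_conv_Cons)
  ultimately have "queue_view x sep N (cells c m @ [sep]) (length (codes (map g [0..<j])) + Suc ?q) \<leadsto>
      queue_view (cell c j) (cell c (Suc j)) (N' + cell c (Suc j) + 2)
        ((?R @ sep # map g [0..<j]) @ [g j]) (Suc p)"
    unfolding o by (auto elim!: view_reach_trans)
  then show ?case
    by (intro exI[of _ "N' + cell c (Suc j) + 2"]) (simp add: before_def add_ac)
qed

text \<open>The successor needs \<open>Suc m\<close> cells because the head may move from the last
  cell to cell \<open>m\<close>.\<close>

lemma sweep:
  assumes c: "well_formed c" and x: "x \<le> sep" and m: "head c < m" and nh: "\<not> halted M c" and blank: "tape c m = 0"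
  shows "\<exists>x' N'. x' \<le> sep \<and>
    queue_view x sep N (cells c m @ [sep])
      (length (codes (cells (step M c) (Suc m) @ [sep])) + Suc p) \<leadsto>
    queue_view x' sep N' (cells (step M c) (Suc m) @ [sep]) (Suc p)"
proof -
  obtain j where j: "m = Suc j" using m by (cases m) auto
  let ?g = "cell (step M c)"
  let ?o = "[?g j, ?g m, sep]"
  let ?q = "length (codes ?o) + p"
  have "\<exists>N'. queue_view x sep N (cells c m @ [sep]) (length (codes (map ?g [0..<j])) + Suc ?q) \<leadsto>
      queue_view (before c j) (cell c j) N' (map (cell c) [Suc j..<m] @ sep # map ?g [0..<j]) (Suc ?q)"
    using nh by (intro sweep_prefix c x) (simp_all add: j verdict_cell[OF c] next_cell_step[OF c])
  then obtain N' where 1: "queue_view x sep N (cells c m @ [sep]) (length (codes (map ?g [0..<j])) + Suc ?q) \<leadsto>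
      queue_view (before c j) (cell c j) N' (sep # map ?g [0..<j]) (Suc ?q)"
    by (auto simp: j)
  have lh: "leaving sep Left = 0" by (simp add: leaving_def mark_sep)
  have lc: "leaving (cell c i) Left = 0" if "i \<ge> m" for i
    using that m c by (simp add: leaving_def headed_cell)
  \<comment> \<open>The literal \<open>0\<close> in \<open>out\<close> stands for cell
    \<open>m\<close> of \<open>c\<close>, which is blank and not under the head.\<close>
  have "cell c m = 0" using m blank by (simp add: cell_def)
  moreover have "before c m = cell c j" by (simp add: before_def j)
  ultimately have o2: "next_cell (cell c j) 0 sep = ?g m"
    using next_cell_step[OF c nh, of sep m] lh lc[of "Suc m"] by simp
  have o1: "next_cell (before c j) (cell c j) sep = ?g j"
    using next_cell_step[OF c nh, of sep j] lh lc[of m] j by simp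
  have o: "out (before c j) (cell c j) sep = ?o"
    using cell_less[OF c, of j] by (simp add: out_def o1 o2)
  have "queue_view (before c j) (cell c j) N' (sep # map ?g [0..<j])
      (length (codes (out (before c j) (cell c j) sep)) + Suc p) \<leadsto>
    queue_view (cell c j) sep (N' + sep + 2) (map ?g [0..<j] @ out (before c j) (cell c j) sep) (Suc p)"
    using before_le[OF c, of j] cell_less[OF c, of j] cell_less[OF well_formed_step[OF c]] verdict_sep
    by (intro queue_step) (auto simp: less_Suc_eq le_less o)
  with 1 have "queue_view x sep N (cells c m @ [sep]) (length (codes (map ?g [0..<j])) + Suc ?q) \<leadsto>
      queue_view (cell c j) sep (N' + sep + 2) (map ?g [0..<j] @ ?o) (Suc p)"
    unfolding o by (auto elim!: view_reach_trans)
  then show ?thesis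
    using cell_less[OF c, of j]
    by (intro exI[of _ "cell c j"] exI[of _ "N' + sep + 2"]) (simp add: cells_def j add_ac)
qed

text \<open>The verdict falls when the cell under the head is popped; until then only copies of
  cells to its left are appended, so \<open>p\<close> suffices.\<close>

lemma sweep_halted:
  assumes c: "well_formed c" and x: "x \<le> sep" and m: "head c < m" and h: "halted M c"
    and p: "p > length (codes (cells c m))"
  shows "\<exists>l r. queue_view x sep N (cells c m @ [sep]) p \<leadsto> (answer (state c = accept M), l, r)"
proof (cases "head c")
  case 0
  have "cells c m = cell c 0 # map (cell c) [Suc 0..<m]"
    using m by (simp add: cells_def upt_conv_Cons)
  moreover obtain p' where "p = Suc p'" using p by (cases p) auto
  moreover have "verdict (cell c 0) = Some (state c = accept M)"
    using h 0 by (simp add: verdict_cell[OF c])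
  ultimately show ?thesis
    using queue_halt[of "cell c 0" "state c = accept M" x sep N "map (cell c) [Suc 0..<m] @ [sep]" p']
      cell_less[OF c, of 0] by simp
next
  case (Suc j)
  let ?g = "cell c"
  have "[0..<m] = [0..<j] @ [j..<m]" using m Suc upt_add_eq_append[of 0 j "m - j"] by simp
  then have "length (codes (map ?g [0..<j])) \<le> length (codes (cells c m))" by (simp add: cells_def)
  then obtain p' where p': "p = length (codes (map ?g [0..<j])) + Suc p'"
    using p by (metis add_Suc_right less_iff_Suc_add le_less_trans)
  have "\<exists>N'. queue_view x sep N (cells c m @ [sep]) (length (codes (map ?g [0..<j])) + Suc p') \<leadsto>
      queue_view (before c j) (cell c j) N' (map (cell c) [Suc j..<m] @ sep # map ?g [0..<j]) (Suc p')"
    using Suc m by (intro sweep_prefix c x) (simp_all add: verdict_cell[OF c] next_cell_idle[OF c])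
  moreover have "map (cell c) [Suc j..<m] = cell c (Suc j) # map (cell c) [Suc (Suc j)..<m]"
    using m Suc by (simp add: upt_conv_Cons)
  ultimately obtain N' where 1: "queue_view x sep N (cells c m @ [sep]) p \<leadsto>
      queue_view (before c j) (cell c j) N'
        (cell c (Suc j) # map (cell c) [Suc (Suc j)..<m] @ sep # map ?g [0..<j]) (Suc p')"
    by (auto simp: p')
  have "verdict (cell c (Suc j)) = Some (state c = accept M)"
    using h Suc by (simp add: verdict_cell[OF c])
  then obtain l r where "queue_view (before c j) (cell c j) N'
        (cell c (Suc j) # map (cell c) [Suc (Suc j)..<m] @ sep # map ?g [0..<j]) (Suc p') \<leadsto>
      (answer (state c = accept M), l, r)"
    using queue_halt[of "cell c (Suc j)"] cell_less[OF c, of "Suc j"] by (metis less_Suc_eq Suc_eq_plus1)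
  with 1 show ?thesis by (blast intro: view_reach_trans)
qed

lemma length_codes_cells:
  assumes "well_formed c" shows "length (codes (cells c m @ [sep])) \<le> (m + 1) * (sep + 2)"
proof -
  have "set (cells c m @ [sep]) \<subseteq> {..<sep + 1}"
    using cell_less[OF assms] by (auto simp: cells_def less_Suc_eq)
  from length_codes_le[OF this] show ?thesis by (simp add: cells_def)
qed

text \<open>Each pass adds one cell, so no configuration exceeds \<open>m + d\<close> cells and a
  separator. The budget \<open>p\<close> allows this size for \<open>d\<close> complete passes and
  the final one.\<close>

lemma sweeps:
  assumes "well_formed c" "x \<le> sep" "head c < m" "\<And>i. i \<ge> m \<Longrightarrow> tape c i = 0"
    and "halted M ((step M ^^ d) c)" "\<And>i. i < d \<Longrightarrow> \<not> halted M ((step M ^^ i) c)"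
    and "p > (d + 1) * ((m + d + 1) * (sep + 2))"
  shows "\<exists>l r. queue_view x sep N (cells c m @ [sep]) p \<leadsto>
    (answer (state ((step M ^^ d) c) = accept M), l, r)"
  using assms
proof (induction d arbitrary: c x m p N)
  case 0
  have "length (codes (cells c m)) \<le> length (codes (cells c m @ [sep]))" by simp
  also have "\<dots> < p" using length_codes_cells[OF 0(1), of m] 0 by simp
  finally show ?case using 0 sweep_halted[of c x m p N] by simp
next
  case (Suc d)
  let ?c = "step M c"
  let ?l = "length (codes (cells ?c (Suc m) @ [sep]))"
  have nh: "\<not> halted M c" using Suc.prems(6)[of 0] by simp
  have wfc: "well_formed ?c" using Suc.prems(1) by (rule well_formed_step)
  let ?b = "(Suc m + d + 1) * (sep + 2)"
  have "?l \<le> (Suc m + 1) * (sep + 2)" by (rule length_codes_cells[OF wfc])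
  also have "\<dots> \<le> ?b" by (intro mult_le_mono1) simp
  finally have l: "?l \<le> ?b" .
  \<comment> \<open>The allowance \<open>?b\<close> for one pass stays the same, since
    \<open>m\<close> grows by one as \<open>d\<close> drops by one.\<close>
  have "(Suc d + 1) * ((m + Suc d + 1) * (sep + 2)) = ?b + (d + 1) * ?b" by simp
  then have pb: "p > ?b + (d + 1) * ?b" using Suc.prems(7) by simp
  then have "p > ?l" using l by simp
  then obtain p' where p': "p = ?l + Suc p'" by (metis add_Suc_right less_iff_Suc_add)
  have "tape c m = 0" using Suc.prems(4) by simp
  then obtain x' N' where 1: "x' \<le> sep" "queue_view x sep N (cells c m @ [sep]) (?l + Suc p') \<leadsto>
      queue_view x' sep N' (cells ?c (Suc m) @ [sep]) (Suc p')"
    using sweep[OF Suc.prems(1,2,3) nh] by blast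
  obtain q b dd where dl: "delta M (state c) (tape c (head c)) = (q, b, dd)" by (metis prod_cases3)
  have "head ?c < Suc m" using Suc.prems(3) nh dl by (cases dd) (auto simp: step_def)
  moreover have "tape ?c i = 0" if "i \<ge> Suc m" for i
    using that Suc.prems(3) Suc.prems(4)[of i] nh dl by (simp add: step_def)
  moreover have "halted M ((step M ^^ d) ?c)" using Suc.prems(5) by (simp add: funpow_swap1)
  moreover have "\<not> halted M ((step M ^^ i) ?c)" if "i < d" for i
    using Suc.prems(6)[of "Suc i"] that by (simp add: funpow_swap1)
  moreover have "Suc p' > (d + 1) * ?b" using pb p' l by linarith
  ultimately obtain l r where "queue_view x' sep N' (cells ?c (Suc m) @ [sep]) (Suc p') \<leadsto>
      (answer (state ((step M ^^ d) ?c) = accept M), l, r)"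
    using Suc.IH[OF wfc 1(1)] by blast
  with 1(2) show ?case unfolding p' by (auto simp: funpow_swap1 intro: view_reach_trans)
qed

text \<open>The first summand is for the recoded input with its separator, the second for the passes
  with \<open>t\<close> the running time; 4 covers the delimiting block 00 and the strict inequality
  in \<open>sweeps\<close>.\<close>

definition space_bound :: "nat \<Rightarrow> nat \<Rightarrow> nat" where
  "space_bound n t = (n + 1) * (sep + 2) + (t + 1) * ((n + t + 1) * (sep + 2)) + 4"

lemma initial_cells:
  assumes "w \<noteq> []"
  shows "queue_input w = cells (initial M (plain_input w)) (length w) @ [sep]"
proof -
  obtain b bs where w: "w = b # bs" using assms by (cases w) auto
  show ?thesis
    unfolding w cells_def
    by (auto simp: inp_def cell_def initial_def plain_input_def upt_conv_Cons
        map_upt_Suc simp del: upt_Suc intro!: nth_equalityI)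
qed

lemma well_formed_initial: "well_formed (initial M (plain_input w))"
proof -
  have "set (plain_input w) \<subseteq> {..<num_symbols M}" using three by (auto simp: plain_input_def)
  then show ?thesis using run_wellformed[OF tm, of "plain_input w" 0] by (simp add: well_formed_def run_0)
qed

lemma simulate:
  assumes halts: "halted M (run M (plain_input w) n)" and "w \<noteq> []"
  shows "\<exists>l r. view (Fetch True) []
      (paired_input w @ replicate (space_bound (length w) (running_time M (plain_input w))) 0) \<leadsto>
    (answer (state (run M (plain_input w) (running_time M (plain_input w))) = accept M), l, r)"
proof -
  let ?T = "running_time M (plain_input w)" and ?c = "initial M (plain_input w)"
  let ?n = "length w"
  let ?b = "(?T + 1) * ((?n + ?T + 1) * (sep + 2))"
  have "length (codes (queue_input w)) \<le> (?n + 1) * (sep + 2)"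
    unfolding initial_cells[OF assms(2)] by (rule length_codes_cells[OF well_formed_initial])
  then have "2 + length (codes (queue_input w)) + Suc (Suc ?b) \<le> space_bound ?n ?T"
    by (simp add: space_bound_def)
  then obtain k where "space_bound ?n ?T = 2 + length (codes (queue_input w)) + Suc (Suc ?b) + k"
    using le_Suc_ex by blast
  then have p: "space_bound ?n ?T = 2 + length (codes (queue_input w)) + Suc (Suc ?b + k)" by simp
  have "view (Fetch True) [] (paired_input w @ replicate (space_bound ?n ?T) 0) \<leadsto>
      queue_view sep sep (2 * ?n + 2) (cells ?c ?n @ [sep]) (Suc (Suc ?b + k))"
    unfolding p initial_cells[OF assms(2), symmetric] by (rule recode_input[OF assms(2)])
  moreover have "\<exists>l r. queue_view sep sep (2 * ?n + 2) (cells ?c ?n @ [sep]) (Suc (Suc ?b + k)) \<leadsto>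
      (answer (state ((step M ^^ ?T) ?c) = accept M), l, r)"
  proof (rule sweeps[OF well_formed_initial])
    show "halted M ((step M ^^ ?T) ?c)"
      using running_time_halted[OF halts] by (simp add: run_def)
    show "\<not> halted M ((step M ^^ i) ?c)" if "i < ?T" for i
      using running_time_le[of M "plain_input w" i] that by (auto simp: run_def)
  qed (use assms(2) in \<open>simp_all add: initial_def plain_input_def\<close>)
  ultimately show ?thesis unfolding run_def by (blast intro: view_reach_trans)
qed

end

lemma PTIME_subset_DWO_PSPACE: "PTIME \<subseteq> DWO_PSPACE"
proof
  fix L assume "L \<in> PTIME"
  then obtain M where M: "turing_machine M" "num_symbols M \<ge> 3" "decides plain_input M L"
    and time: "poly_bounded (\<lambda>w. running_time M (plain_input w))"
    by (auto simp: PTIME_def poly_bounded_def)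
  interpret simulation M "[] \<in> L" using M by unfold_locales
  obtain e where "finite_control states wdelta (Fetch True) Accept Reject e"
    using finite_control_exists by blast
  then interpret W: finite_control states wdelta "Fetch True" Accept Reject e .
  let ?T = "\<lambda>w. running_time M (plain_input w)"
  let ?p = "\<lambda>w. space_bound (length w) (?T w)"
  have reach: "\<exists>l r. view_reach wdelta {Accept, Reject} (Fetch True, [], paired_input w @ replicate (?p w) 0)
      (answer (w \<in> L), l, r)" for w
  proof (cases "w = []")
    case True
    have "?p w = Suc (Suc (Suc (?p w - 3)))" by (simp add: space_bound_def)
    then show ?thesis using empty_input[of "?p w - 3"] True by (simp add: paired_input_simps)
  next
    case False
    obtain n where n: "state (run M (plain_input w) n) = (if w \<in> L then accept M else reject M)"
      using M(3) by (auto simp: decides_def)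
    then have h: "halted M (run M (plain_input w) n)" by (auto simp: halted_def)
    have "run M (plain_input w) n = run M (plain_input w) (?T w)"
      using running_time_halted[OF h] running_time_le[OF h] by (rule run_halted)
    then have "state (run M (plain_input w) (?T w)) = accept M \<longleftrightarrow> w \<in> L"
      using n M(1) by (auto simp: turing_machine_def)
    then show ?thesis using simulate[OF h False] by simp
  qed
  have halts: "answer b = Accept \<or> answer b = Reject" for b by (simp add: answer_def)
  have two: "set (paired_input w) \<subseteq> {..<2}" for w by (rule set_paired_input)
  have pos: "length (paired_input w) + ?p w > 0" for w by (simp add: space_bound_def)
  have decided: "\<exists>t. state (run W.M (paired_input w) t) = e (answer (w \<in> L))"
    and space: "space_usage W.M (paired_input w) \<le> length (paired_input w) + ?p w" for w
    using reach[of w] W.space_usage_compile[OF _ halts two pos] by blast+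
  have "e (answer b) = (if b then accept W.M else reject W.M)" for b
    by (simp add: answer_def compile_def)
  with decided have "decides paired_input W.M L"
    unfolding decides_def by simp
  moreover have "poly_bounded (\<lambda>w. space_usage W.M (paired_input w))"
  proof (rule poly_bounded_mono[OF _ space])
    show "poly_bounded (\<lambda>w. length (paired_input w) + ?p w)"
      unfolding space_bound_def length_paired_input by (intro poly_bounded_intros time)
  qed
  ultimately show "L \<in> DWO_PSPACE"
    using W.write_once_compile by (auto simp: DWO_PSPACE_def poly_bounded_def)
qed

theorem theorem1:
  shows "DWO_PSPACE = PTIME"
  using DWO_PSPACE_subset_PTIME PTIME_subset_DWO_PSPACE by (rule equalityI)

end
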